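(* For all integers $\alpha \geq 1$ and $n \geq 0$, \begin{align*} \mathfrak{B}_{5^{2\alpha-1}}\!\left(2\cdot 5^{2\alpha}n+\frac{101 \cdot 5^{2\alpha-1}-1}{12}\right) &\equiv 0 \pmod 5,\\ \mathfrak{B}_{7^{2\alpha-1}}\!\left(2\cdot 7^{2\alpha}n+\frac{127 \cdot 7^{2\alpha-1}-1}{12}\right) &\equiv 0 \pmod 7,\\ \mathfrak{B}_{11^{2\alpha-1}}\!\left(2\cdot 11^{2\alpha}n+\frac{155 \cdot 11^{2\alpha-1}-1}{12}\right) &\equiv 0 \pmod{11}. \end{align*}
   Context: For $|q|<1$ write $(a;q)_\infty=\prod_{j=0}^{\infty}(1-aq^j)$. For an integer $k\geq 3$, $\mathfrak{B}_k(n)$ denotes the number of $k$ dots bracelet partitions of $n$; these integers are determined by the generating function \[ \sum_{n=0}^{\infty}\mathfrak{B}_{k}(n)q^n=\frac{(-q;q)_{\infty}}{(q;q)_{\infty}^{k-1}(-q^k;q^k)_{\infty}} . \] *)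

theory Defs
  imports "HOL-Analysis.Analysis" "HOL-Number_Theory.Cong"
begin

text \<open>
  The product is taken in the ring of formal power series over the integers, with respect to its
  usual (coefficientwise) topology. It converges whenever \<open>a\<close> and \<open>q\<close> are nonzero with zero
  constant term, see \<open>qpochhammer_inf_has_prod\<close> below.
\<close>
definition qpochhammer_inf :: "int fps \<Rightarrow> int fps \<Rightarrow> int fps" where
  "qpochhammer_inf a q = (\<Prod>j. 1 - a * q ^ j)"

text \<open>
  The numerator and the denominator of
  \<open>(-q;q)\<^sub>\<infinity> / ((q;q)\<^sub>\<infinity>\<^bsup>k-1\<^esup> (-q\<^sup>k;q\<^sup>k)\<^sub>\<infinity>)\<close>, with the indeterminate \<open>fps_X\<close> for \<open>q\<close>. The denominator
  has constant term 1, so it is invertible over the integers. As \<open>int\<close> is not of class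
  \<open>inverse\<close>, the quotient is written with \<open>fps_right_inverse\<close>, whose second argument is the
  constant term of the inverse.
\<close>
definition dots_bracelet_num :: "int fps" where
  "dots_bracelet_num = qpochhammer_inf (- fps_X) fps_X"

definition dots_bracelet_denom :: "nat \<Rightarrow> int fps" where
  "dots_bracelet_denom k =
     qpochhammer_inf fps_X fps_X ^ (k - 1) * qpochhammer_inf (- (fps_X ^ k)) (fps_X ^ k)"

text \<open>The number of \<open>k\<close> dots bracelet partitions of \<open>n\<close>, for \<open>k \<ge> 3\<close>.\<close>
definition dots_bracelet :: "nat \<Rightarrow> nat \<Rightarrow> int" where
  "dots_bracelet k n =
     fps_nth (dots_bracelet_num * fps_right_inverse (dots_bracelet_denom k) 1) n"

lemma qpochhammer_inf_aux:
  assumes "a \<noteq> 0" "q \<noteq> 0" "fps_nth a 0 = 0" "fps_nth q 0 = 0"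
  obtains P where "raw_has_prod (\<lambda>j. 1 - a * q ^ j) 0 P" "fps_nth P 0 = (1 :: int)"
proof -
  define f where "f = (\<lambda>j. 1 - a * q ^ j)"
  have f0: "fps_nth (f j) 0 = 1" for j
    using assms by (simp add: f_def)
  have nz: "f j \<noteq> 0" for j
    using f0[of j] by auto
  have "subdegree (f k - 1) > n" if "k > n" for n k
  proof -
    have "f k - 1 = - (a * q ^ k)"
      by (simp add: f_def)
    hence "subdegree (f k - 1) = subdegree a + k * subdegree q"
      using assms by simp
    moreover have "subdegree a > 0" "subdegree q > 0"
      using assms by (simp_all add: subdegree_eq_0_iff flip: neq0_conv)
    ultimately show ?thesis
      using that by (metis One_nat_def Suc_leI le_add2 less_le_trans mult.right_neutral mult_le_mono2)
  qed
  then obtain P where P: "(\<lambda>n. \<Prod>k\<le>n. f k) \<longlonglongrightarrow> P"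
    using tendsto_prod_fps[of f "\<lambda>n. n"] nz by blast
  have "eventually (\<lambda>n. fps_nth (\<Prod>k\<le>n. f k) 0 = fps_nth P 0) sequentially"
    using P by (simp add: tendsto_fps_iff)
  moreover have "fps_nth (\<Prod>k\<le>n. f k) 0 = 1" for n
    by (induction n) (simp_all add: f0)
  ultimately have P0: "fps_nth P 0 = 1"
    by simp
  hence "raw_has_prod f 0 P"
    using P by (auto simp: raw_has_prod_def)
  thus ?thesis
    using that P0 by (simp add: f_def)
qed

lemma
  assumes "a \<noteq> 0" "q \<noteq> 0" "fps_nth a 0 = 0" "fps_nth q 0 = 0"
  shows qpochhammer_inf_has_prod: "(\<lambda>j. 1 - a * q ^ j) has_prod qpochhammer_inf a q"
    and qpochhammer_inf_nth_0: "fps_nth (qpochhammer_inf a q) 0 = 1"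
proof -
  obtain P where P: "raw_has_prod (\<lambda>j. 1 - a * q ^ j) 0 P" "fps_nth P 0 = 1"
    using qpochhammer_inf_aux[OF assms] .
  have *: "(\<lambda>j. 1 - a * q ^ j) has_prod P"
    using P(1) by (simp add: has_prod_def)
  have "P = qpochhammer_inf a q"
    unfolding qpochhammer_inf_def by (rule has_prod_unique[OF *])
  with * P(2) show "(\<lambda>j. 1 - a * q ^ j) has_prod qpochhammer_inf a q"
    and "fps_nth (qpochhammer_inf a q) 0 = 1"
    by simp_all
qed

lemma dots_bracelet_denom_nth_0: "k > 0 \<Longrightarrow> fps_nth (dots_bracelet_denom k) 0 = 1"
  by (simp add: dots_bracelet_denom_def qpochhammer_inf_nth_0 fps_power_zeroth)

theorem dots_bracelet_gf:
  assumes "k \<ge> 3"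
  shows "Abs_fps (dots_bracelet k) * dots_bracelet_denom k = dots_bracelet_num"
proof -
  have "Abs_fps (dots_bracelet k) =
          dots_bracelet_num * fps_right_inverse (dots_bracelet_denom k) 1"
    by (rule fps_ext) (simp add: dots_bracelet_def)
  moreover have "dots_bracelet_denom k * fps_right_inverse (dots_bracelet_denom k) 1 = 1"
    using assms by (intro fps_right_inverse) (simp add: dots_bracelet_denom_nth_0)
  ultimately show ?thesis
    by (simp add: mult.assoc mult.commute)
qed

text \<open>The divisions by 12 in the arguments of the main statement are exact.\<close>
lemma twelve_dvd_arguments:
  assumes "\<alpha> \<ge> (1::nat)"
  shows "12 dvd (101 * 5 ^ (2 * \<alpha> - 1) - 1 :: nat)"
    and "12 dvd (127 * 7 ^ (2 * \<alpha> - 1) - 1 :: nat)"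
    and "12 dvd (155 * 11 ^ (2 * \<alpha> - 1) - 1 :: nat)"
proof -
  obtain b where b: "2 * \<alpha> - 1 = Suc (2 * b)"
    using assms by (cases \<alpha>) auto
  have "[(c ^ 2) ^ b = 1 ^ b] (mod 12)" if "[c ^ 2 = 1] (mod 12)" for c :: nat
    using that by (rule cong_pow)
  from this[of 5] this[of 7] this[of 11]
  have *: "[25 ^ b = 1] (mod 12::nat)" "[49 ^ b = 1] (mod 12::nat)" "[121 ^ b = 1] (mod 12::nat)"
    by (simp_all add: cong_def)
  have "12 dvd (d * c ^ Suc (2 * b) - 1)"
    if "[(c ^ 2) ^ b = 1] (mod 12)" "[d * c = 1] (mod 12)" for c d :: nat
  proof -
    have "[d * c * (c ^ 2) ^ b = 1 * 1] (mod 12)"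
      using that by (intro cong_mult)
    moreover have "d * c * (c ^ 2) ^ b = d * c ^ Suc (2 * b)"
      by (simp add: power_mult)
    ultimately have "[d * c ^ Suc (2 * b) = 1] (mod 12)"
      by simp
    thus ?thesis
      by (metis cong_to_1_nat)
  qed
  from this[of 5 101] this[of 7 127] this[of 11 155] *
  show "12 dvd (101 * 5 ^ (2 * \<alpha> - 1) - 1 :: nat)"
    and "12 dvd (127 * 7 ^ (2 * \<alpha> - 1) - 1 :: nat)"
    and "12 dvd (155 * 11 ^ (2 * \<alpha> - 1) - 1 :: nat)"
    unfolding b by (simp_all add: cong_def)
qed

end

theory Submission
  imports Defs "HOL-Number_Theory.Residues" "HOL-Computational_Algebra.Formal_Laurent_Series"
begin

text \<open>
  Write \<open>E(q) = (q;q)\<^sub>\<infinity>\<close> and let \<open>k = p\<^bsup>2\<alpha>-1\<^esup>\<close> with \<open>p \<in> {5, 7, 11}\<close>.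

  Since \<open>f(q)\<^sup>k \<equiv> f(q\<^sup>k)\<close> modulo \<open>p\<close> for every integer power series \<open>f\<close>, and since
  \<open>(q;q)\<^sub>\<infinity> (-q;q)\<^sub>\<infinity> = (q\<^sup>2;q\<^sup>2)\<^sub>\<infinity>\<close>, the generating function collapses modulo \<open>p\<close> to
  \<open>E(q\<^sup>2) / E(q\<^bsup>2k\<^esup>)\<close> (\<open>dots_bracelet_cong\<close>). All the indices in the theorem are even, so the claim
  is about the coefficient of order \<open>M\<close> in \<open>E(q) / E(q\<^sup>k)\<close>, where \<open>M\<close> is half of the index.

  By Euler's pentagonal number theorem the exponents \<open>n\<close> that occur in \<open>E\<close> are those for which
  \<open>24 n + 1\<close> is a square. With \<open>r = (p\<^sup>2 - 1) / 24\<close> one has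
  \<open>24 (p\<^sup>2 n + r) + 1 = p\<^sup>2 (24 n + 1)\<close>, so picking the exponents \<open>p\<^sup>2 n + r\<close> out of \<open>E\<close> reproduces
  \<open>E\<close> up to sign, and no other exponent of \<open>E\<close> is congruent to \<open>r\<close> modulo \<open>p\<close>. When \<open>p\<^sup>2\<close>
  divides \<open>k\<close>, this selection takes \<open>E(q) / E(q\<^sup>k)\<close> to \<open>\<plusminus> E(q) / E(q\<^bsup>k/p\<^sup>2\<^esup>)\<close>
  (\<open>euler_quotient_descent\<close>). The numbers 101, 127 and 155 have the form \<open>24 s + p\<close> with
  \<open>s = 4, 5, 6\<close>, and the relation \<open>24 M + 1 = (24 s + p) k\<close> for the least half index \<open>M\<close> is
  compatible with the descent, which thus reaches \<open>k = p\<close>. There, selecting the exponents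
  \<open>p i + r\<close> gives \<open>\<plusminus> E(q\<^sup>p) / E(q) \<equiv> \<plusminus> E(q)\<^bsup>p-1\<^esup>\<close>, and it remains to see that \<open>p\<close> divides the
  coefficients of order \<open>p n + s\<close> in \<open>E\<^bsup>p-1\<^esup>\<close>. These are Ramanujan's congruences for the partition
  function in a multiplicative form.

  For 5 and 7, write \<open>E\<^sup>4 = E E\<^sup>3\<close> and \<open>E\<^sup>6 = E\<^sup>3 E\<^sup>3\<close>. By Jacobi's formula the exponents of \<open>E\<^sup>3\<close> are
  the numbers \<open>n\<close> for which \<open>8 n + 1\<close> is a square \<open>y\<^sup>2\<close>, with coefficient \<open>\<plusminus> y\<close>. If \<open>x\<^sup>2\<close>
  is the square that belongs to the first factor, the exponents in question force
  \<open>x\<^sup>2 + 3 y\<^sup>2 \<equiv> 0\<close> modulo 5 or \<open>x\<^sup>2 + y\<^sup>2 \<equiv> 0\<close> modulo 7, hence \<open>p dvd y\<close>, and \<open>p\<close> divides every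
  contribution to the coefficient.

  For 11 the argument follows Hirschhorn. Put \<open>J = E\<^sup>3\<close>, which modulo 11 has only exponents congruent
  to 0, 1, 3, 6 or 10. On the one hand \<open>J\<^sup>4 = E\<^bsup>12\<^esup> \<equiv> E(q) E(q\<^bsup>11\<^esup>)\<close>, and no exponent of \<open>E\<close> is
  congruent to 3, 6, 8, 9 or 10: this gives five quartic relations between the five residue parts of
  \<open>J\<close>. On the other hand \<open>J\<^sup>7 = E\<^bsup>21\<^esup> \<equiv> E(q)\<^bsup>10\<^esup> E(q\<^bsup>11\<^esup>)\<close>, so that it suffices that the part of \<open>J\<^sup>7\<close>
  with exponents congruent to 6 vanishes. As a polynomial in the parts of \<open>J\<close>, it lies in the
  ideal generated by the five relations and 11 (\<open>residue_part_power_7_in_ideal\<close>).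

  The theorems of Euler and Jacobi are obtained as limits of finite identities that can be proved
  by induction.
\<close>

section \<open>Congruences in commutative rings\<close>

text \<open>
  The same relation serves two purposes: with a prime as modulus it is the congruence of integer
  power series modulo that prime, with a power of the indeterminate as modulus it is the
  agreement of two power series up to a given order.
\<close>
definition ring_cong :: "'a::comm_ring_1 \<Rightarrow> 'a \<Rightarrow> 'a \<Rightarrow> bool" ("(1[_ = _] '(rmod _'))")
  where "[f = g] (rmod m) \<longleftrightarrow> m dvd f - g" for m f g

lemma ring_cong_refl [simp]: "[f = f] (rmod m)"
  by (simp add: ring_cong_def)

lemma ring_cong_sym: "[f = g] (rmod m) \<Longrightarrow> [g = f] (rmod m)"
  unfolding ring_cong_def by (metis dvd_minus_iff minus_diff_eq)

lemma ring_cong_trans [trans]: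
  "[f = g] (rmod m) \<Longrightarrow> [g = h] (rmod m) \<Longrightarrow> [f = h] (rmod m)"
  unfolding ring_cong_def using dvd_add[of m "f - g" "g - h"] by simp

lemma ring_cong_add:
  "[f = g] (rmod m) \<Longrightarrow> [f' = g'] (rmod m) \<Longrightarrow> [f + f' = g + g'] (rmod m)"
  unfolding ring_cong_def using dvd_add[of m "f - g" "f' - g'"] by (simp add: algebra_simps)

lemma ring_cong_sum:
  "(\<And>i. i \<in> A \<Longrightarrow> [f i = g i] (rmod m)) \<Longrightarrow> [sum f A = sum g A] (rmod m)"
  by (induction A rule: infinite_finite_induct) (auto intro: ring_cong_add)

lemma ring_cong_mult:
  assumes "[f = g] (rmod m)" "[f' = g'] (rmod m)"
  shows "[f * f' = g * g'] (rmod m)"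
proof -
  have "f * f' - g * g' = (f - g) * f' + g * (f' - g')"
    by (simp add: algebra_simps)
  thus ?thesis
    using assms unfolding ring_cong_def by (metis dvd_add dvd_mult dvd_mult2)
qed

lemma ring_cong_power: "[f = g] (rmod m) \<Longrightarrow> [f ^ n = g ^ n] (rmod m)"
  by (induction n) (auto intro: ring_cong_mult)

lemma fps_const_dvd_iff:
  fixes f :: "'a::comm_ring_1 fps"
  shows "fps_const c dvd f \<longleftrightarrow> (\<forall>n. c dvd fps_nth f n)"
proof
  assume "fps_const c dvd f"
  thus "\<forall>n. c dvd fps_nth f n"
    by (auto simp: dvd_def)
next
  assume "\<forall>n. c dvd fps_nth f n"
  then obtain g where "\<And>n. fps_nth f n = c * g n"
    unfolding dvd_def by metis
  hence "f = fps_const c * Abs_fps g"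
    by (simp add: fps_eq_iff)
  thus "fps_const c dvd f"
    by simp
qed

lemma ring_cong_fps_const_iff:
  "[f = g] (rmod fps_const c) \<longleftrightarrow> (\<forall>n. [fps_nth f n = fps_nth g n] (rmod c))"
  by (auto simp: ring_cong_def fps_const_dvd_iff)

lemma ring_cong_fps_X_power_iff:
  fixes f g :: "'a::comm_ring_1 fps"
  shows "[f = g] (rmod fps_X ^ N) \<longleftrightarrow> (\<forall>n<N. fps_nth f n = fps_nth g n)"
proof
  assume "[f = g] (rmod fps_X ^ N)"
  then obtain h where "f - g = fps_X ^ N * h"
    by (auto simp: ring_cong_def)
  hence "fps_nth (f - g) n = 0" if "n < N" for n
    using that by (simp add: fps_X_power_mult_nth)
  thus "\<forall>n<N. fps_nth f n = fps_nth g n"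
    by simp
next
  assume "\<forall>n<N. fps_nth f n = fps_nth g n"
  hence "f - g = fps_X ^ N * fps_shift N (f - g)"
    by (auto simp: fps_eq_iff fps_X_power_mult_nth)
  thus "[f = g] (rmod fps_X ^ N)"
    unfolding ring_cong_def by (metis dvd_triv_left)
qed

lemma ring_cong_int_iff: "[a = b] (rmod m) \<longleftrightarrow> [a = b] (mod m)" for a b m :: int
  by (simp add: ring_cong_def cong_iff_dvd_diff)

section \<open>Frobenius modulo a prime\<close>

lemma freshmans_dream_ring_cong:
  fixes x y :: "'a::comm_ring_1"
  assumes "prime p"
  shows "[(x + y) ^ p = x ^ p + y ^ p] (rmod of_nat p)"
proof -
  have p0: "p > 0"
    using assms by (simp add: prime_gt_0_nat)
  have "(x + y) ^ p = (\<Sum>k\<le>p. of_nat (p choose k) * x ^ k * y ^ (p - k))"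
    by (rule binomial_ring)
  also have "[(\<Sum>k\<le>p. of_nat (p choose k) * x ^ k * y ^ (p - k)) =
               (\<Sum>k\<le>p. if k \<in> {0, p} then x ^ k * y ^ (p - k) else 0)] (rmod of_nat p)"
  proof (rule ring_cong_sum)
    fix k assume "k \<in> {..p}"
    show "[of_nat (p choose k) * x ^ k * y ^ (p - k) =
            (if k \<in> {0, p} then x ^ k * y ^ (p - k) else 0)] (rmod of_nat p)"
    proof (cases "k \<in> {0, p}")
      case False
      hence "p dvd (p choose k)"
        using \<open>k \<in> {..p}\<close> assms by (intro dvd_choose_prime) auto
      hence "(of_nat p :: 'a) dvd of_nat (p choose k)"
        by (metis dvd_def of_nat_mult)
      thus ?thesis
        using False by (simp add: ring_cong_def)
    qed auto
  qed
  also have "(\<Sum>k\<le>p. if k \<in> {0, p} then x ^ k * y ^ (p - k) else 0) =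
             (\<Sum>k\<in>{0, p}. x ^ k * y ^ (p - k))"
    by (subst sum.inter_filter [symmetric]) (auto intro!: sum.cong)
  also have "\<dots> = x ^ p + y ^ p"
    using p0 by simp
  finally show ?thesis .
qed

lemma fermat_little_int:
  fixes c :: int
  assumes "prime p"
  shows "[c ^ p = c] (mod int p)"
proof (cases "int p dvd c")
  case True
  moreover have "int p dvd c ^ p"
    using True assms by (simp add: dvd_power_le prime_gt_0_nat dvd_trans[OF _ dvd_power])
  ultimately show ?thesis
    by (simp add: cong_iff_dvd_diff)
next
  case False
  have "[nat (c mod int p) ^ (p - 1) = 1] (mod p)"
  proof (rule fermat_theorem[OF assms])
    have "\<not> int p dvd c mod int p"
      using False by (simp add: dvd_mod_iff)
    thus "\<not> p dvd nat (c mod int p)"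
      using assms
      by (metis int_dvd_int_iff int_nat_eq pos_mod_sign prime_gt_0_nat of_nat_0_less_iff)
  qed
  hence "[int (nat (c mod int p) ^ (p - 1)) = int 1] (mod int p)"
    by (simp only: cong_int_iff)
  hence "[(c mod int p) ^ (p - 1) = 1] (mod int p)"
    using assms by (simp add: prime_gt_0_nat)
  hence "[c ^ (p - 1) = 1] (mod int p)"
    by (simp add: cong_def power_mod)
  hence "[c ^ (p - 1) * c = 1 * c] (mod int p)"
    by (rule cong_mult) simp
  thus ?thesis
    using assms by (simp add: prime_gt_0_nat power_minus_mult del: One_nat_def)
qed

text \<open>
  Splitting off the constant term as \<open>f = c + X g\<close>, the freshman's dream and Fermat's little
  theorem give \<open>f\<^sup>p \<equiv> c + X\<^sup>p g\<^sup>p\<close>, and the claim for the coefficient of order \<open>n\<close> of \<open>f\<close> is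
  reduced to the one of order \<open>n - p\<close> of \<open>g\<close>.
\<close>
lemma fps_power_prime_cong:
  fixes f :: "int fps"
  assumes p: "prime p"
  shows "[f ^ p = f oo fps_X ^ p] (rmod fps_const (int p))"
proof -
  have p0: "p > 0"
    using p by (simp add: prime_gt_0_nat)
  have const: "of_nat p = (fps_const (int p) :: int fps)"
    by (simp add: fps_of_nat)
  have "[fps_nth (f ^ p) n = fps_nth (f oo fps_X ^ p) n] (mod int p)" for n
  proof (induction n arbitrary: f rule: less_induct)
    case (less n)
    define c where "c = fps_nth f 0"
    define g where "g = fps_shift 1 f"
    have f: "f = fps_const c + fps_X * g"
      by (auto simp: fps_eq_iff c_def g_def)
    have "[f ^ p = fps_const c ^ p + (fps_X * g) ^ p] (rmod fps_const (int p))"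
      unfolding const [symmetric] by (subst f) (rule freshmans_dream_ring_cong[OF p])
    hence "[fps_nth (f ^ p) n = fps_nth (fps_const (c ^ p) + fps_X ^ p * g ^ p) n] (mod int p)"
      by (simp add: ring_cong_fps_const_iff ring_cong_int_iff power_mult_distrib)
    also have "[fps_nth (fps_const (c ^ p) + fps_X ^ p * g ^ p) n =
                fps_nth (f oo fps_X ^ p) n] (mod int p)"
    proof (cases "n < p")
      case True
      thus ?thesis
        using p0 fermat_little_int[OF p, of c]
        by (auto simp: fps_X_power_mult_nth fps_nth_compose_X_power c_def dvd_imp_le)
    next
      case False
      hence "[fps_nth (g ^ p) (n - p) = fps_nth (g oo fps_X ^ p) (n - p)] (mod int p)"
        using p0 by (intro less.IH) auto
      moreover have "fps_nth (g oo fps_X ^ p) (n - p) = fps_nth (f oo fps_X ^ p) n"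
        using False p0 by (auto simp: fps_nth_compose_X_power g_def dvd_minus_self le_div_geq)
      ultimately show ?thesis
        using False p0 by (auto simp: fps_X_power_mult_nth)
    qed
    finally show ?case .
  qed
  thus ?thesis
    by (simp add: ring_cong_fps_const_iff ring_cong_int_iff)
qed

lemma fps_compose_X_power_compose_X_power:
  fixes f :: "'a::comm_ring_1 fps"
  assumes "j > 0" "k > 0"
  shows "(f oo fps_X ^ j) oo fps_X ^ k = f oo fps_X ^ (j * k)"
proof (rule fps_ext)
  fix n
  show "fps_nth ((f oo fps_X ^ j) oo fps_X ^ k) n = fps_nth (f oo fps_X ^ (j * k)) n"
    using assms
    by (auto simp: fps_nth_compose_X_power div_mult2_eq mult.commute[of j] elim!: dvdE)
qed

lemma fps_power_prime_power_cong:
  fixes f :: "int fps"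
  assumes p: "prime p"
  shows "[f ^ p ^ m = f oo fps_X ^ (p ^ m)] (rmod fps_const (int p))"
proof (induction m)
  case (Suc m)
  have p0: "p > 0"
    using p by (simp add: prime_gt_0_nat)
  have "f ^ p ^ Suc m = (f ^ p ^ m) ^ p"
    by (simp add: mult.commute flip: power_mult)
  also have "[(f ^ p ^ m) ^ p = (f oo fps_X ^ (p ^ m)) ^ p] (rmod fps_const (int p))"
    by (intro ring_cong_power Suc)
  also have "[(f oo fps_X ^ (p ^ m)) ^ p = (f oo fps_X ^ (p ^ m)) oo fps_X ^ p]
               (rmod fps_const (int p))"
    by (rule fps_power_prime_cong[OF p])
  also have "(f oo fps_X ^ (p ^ m)) oo fps_X ^ p = f oo fps_X ^ (p ^ Suc m)"
    using p0 by (simp add: fps_compose_X_power_compose_X_power mult.commute)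
  finally show ?case .
qed simp

section \<open>The infinite products\<close>

abbreviation euler :: "int fps" where
  "euler \<equiv> qpochhammer_inf fps_X fps_X"

text \<open>The finite product \<open>(q;q)\<^sub>n\<close>.\<close>
definition qfact :: "'a::comm_ring_1 \<Rightarrow> nat \<Rightarrow> 'a" where
  "qfact q n = (\<Prod>i<n. 1 - q ^ Suc i)"

lemma qfact_0 [simp]: "qfact q 0 = 1"
  and qfact_Suc: "qfact q (Suc n) = qfact q n * (1 - q ^ Suc n)"
  by (simp_all add: qfact_def)

lemma qpochhammer_inf_tendsto:
  assumes "a \<noteq> 0" "q \<noteq> 0" "fps_nth a 0 = 0" "fps_nth q 0 = 0"
  shows "(\<lambda>N. \<Prod>j\<le>N. 1 - a * q ^ j) \<longlonglongrightarrow> qpochhammer_inf a q"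
proof -
  have "qpochhammer_inf a q \<noteq> 0"
    using qpochhammer_inf_nth_0[OF assms] by auto
  thus ?thesis
    using qpochhammer_inf_has_prod[OF assms] by (auto simp: has_prod_def raw_has_prod_def)
qed

lemma tendsto_mult_fps:
  fixes f g :: "'b \<Rightarrow> 'a::comm_ring_1 fps"
  assumes "(f \<longlongrightarrow> F) U" "(g \<longlongrightarrow> G) U"
  shows "((\<lambda>x. f x * g x) \<longlongrightarrow> F * G) U"
proof (rule tendsto_fpsI)
  fix n
  have "eventually (\<lambda>x. \<forall>i\<in>{..n}. fps_nth (f x) i = fps_nth F i \<and> fps_nth (g x) i = fps_nth G i) U"
    using assms by (subst eventually_ball_finite_distrib) (auto simp: tendsto_fps_iff intro: eventually_conj)
  thus "eventually (\<lambda>x. fps_nth (f x * g x) n = fps_nth (F * G) n) U"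
    by eventually_elim (auto simp: fps_mult_nth intro!: sum.cong)
qed

lemma tendsto_compose_X_power_fps:
  fixes f :: "'b \<Rightarrow> 'a::comm_ring_1 fps"
  assumes "(f \<longlongrightarrow> F) U"
  shows "((\<lambda>x. f x oo fps_X ^ k) \<longlongrightarrow> F oo fps_X ^ k) U"
proof (rule tendsto_fpsI)
  fix n
  have "eventually (\<lambda>x. fps_nth (f x) (n div k) = fps_nth F (n div k)) U"
    using assms by (simp add: tendsto_fps_iff)
  thus "eventually (\<lambda>x. fps_nth (f x oo fps_X ^ k) n = fps_nth (F oo fps_X ^ k) n) U"
    by eventually_elim (auto simp: fps_nth_compose_X_power)
qed

lemma fps_X_power_compose_X_power:
  assumes "k > 0"
  shows "(fps_X ^ m :: 'a::comm_ring_1 fps) oo fps_X ^ k = (fps_X ^ k) ^ m"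
  using assms by (auto simp: fps_eq_iff fps_nth_compose_X_power simp flip: power_mult)

lemma euler_tendsto: "(\<lambda>N. \<Prod>j\<le>N. 1 - fps_X ^ Suc j) \<longlonglongrightarrow> euler"
  using qpochhammer_inf_tendsto[of fps_X fps_X] by simp

lemma neg_qpochhammer_tendsto:
  "(\<lambda>N. \<Prod>j\<le>N. 1 + fps_X ^ Suc j) \<longlonglongrightarrow> qpochhammer_inf (- fps_X) fps_X"
  using qpochhammer_inf_tendsto[of "- fps_X" fps_X] by simp

lemma euler_mult_neg_qpochhammer:
  "euler * qpochhammer_inf (- fps_X) fps_X = euler oo fps_X ^ 2"
proof (rule LIMSEQ_unique)
  show "(\<lambda>N. (\<Prod>j\<le>N. 1 - fps_X ^ Suc j) * (\<Prod>j\<le>N. 1 + fps_X ^ Suc j)) \<longlonglongrightarrow>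
          euler * qpochhammer_inf (- fps_X) fps_X"
    by (intro tendsto_mult_fps euler_tendsto neg_qpochhammer_tendsto)
  have "(\<Prod>j\<le>N. 1 - fps_X ^ Suc j) * (\<Prod>j\<le>N. 1 + fps_X ^ Suc j) =
        (\<Prod>j\<le>N. 1 - fps_X ^ Suc j) oo (fps_X ^ 2 :: int fps)" for N
  proof -
    have "(\<Prod>j\<le>N. 1 - fps_X ^ Suc j) oo (fps_X ^ 2 :: int fps) =
            (\<Prod>j\<le>N. (1 - fps_X ^ Suc j) oo fps_X ^ 2)"
      by (simp add: fps_compose_prod_distrib)
    also have "\<dots> = (\<Prod>j\<le>N. (1 - fps_X ^ Suc j) * (1 + fps_X ^ Suc j))"
    proof (intro prod.cong refl)
      fix j
      have "(1 - fps_X ^ Suc j :: int fps) oo fps_X ^ 2 = 1 - (fps_X ^ 2) ^ Suc j"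
        by (simp only: fps_compose_sub_distrib fps_compose_1 fps_X_power_compose_X_power
              zero_less_numeral)
      also have "\<dots> = 1 - (fps_X ^ Suc j) ^ 2"
        by (simp only: mult.commute flip: power_mult)
      finally show "(1 - fps_X ^ Suc j :: int fps) oo fps_X ^ 2 =
                      (1 - fps_X ^ Suc j) * (1 + fps_X ^ Suc j)"
        by (simp only: power2_eq_square) (simp add: algebra_simps)
    qed
    finally show ?thesis
      by (simp only: prod.distrib)
  qed
  thus "(\<lambda>N. (\<Prod>j\<le>N. 1 - fps_X ^ Suc j) * (\<Prod>j\<le>N. 1 + fps_X ^ Suc j)) \<longlonglongrightarrow>
          (euler oo fps_X ^ 2)"
    by (simp only: tendsto_compose_X_power_fps[OF euler_tendsto])
qed

lemma neg_qpochhammer_compose: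
  assumes "k > 0"
  shows "qpochhammer_inf (- (fps_X ^ k)) (fps_X ^ k) =
           qpochhammer_inf (- fps_X) fps_X oo fps_X ^ k"
proof (rule LIMSEQ_unique)
  show "(\<lambda>N. \<Prod>j\<le>N. 1 - (- (fps_X ^ k)) * (fps_X ^ k) ^ j) \<longlonglongrightarrow>
          qpochhammer_inf (- (fps_X ^ k)) (fps_X ^ k)"
    using assms by (intro qpochhammer_inf_tendsto) auto
  have "(\<Prod>j\<le>N. 1 - (- (fps_X ^ k)) * (fps_X ^ k) ^ j) =
        (\<Prod>j\<le>N. 1 + fps_X ^ Suc j) oo (fps_X ^ k :: int fps)" for N
    using assms
    by (simp add: fps_compose_prod_distrib fps_compose_add_distrib fps_X_power_compose_X_power
             del: power_Suc) simp
  thus "(\<lambda>N. \<Prod>j\<le>N. 1 - (- (fps_X ^ k)) * (fps_X ^ k) ^ j) \<longlonglongrightarrow>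
          (qpochhammer_inf (- fps_X) fps_X oo fps_X ^ k)"
    by (simp only: tendsto_compose_X_power_fps[OF neg_qpochhammer_tendsto])
qed

lemma qfact_cong_qfact:
  assumes "n \<le> m"
  shows "[qfact q m = qfact q n] (rmod q ^ Suc n)"
  using assms
proof (induction m rule: dec_induct)
  case (step m)
  have "[1 - q ^ Suc m = 1] (rmod q ^ Suc n)"
    using step by (simp add: ring_cong_def le_imp_power_dvd del: power_Suc)
  from ring_cong_mult[OF step.IH this] show ?case
    by (simp add: qfact_Suc)
qed simp

lemma euler_cong_qfact: "[euler = qfact fps_X n] (rmod fps_X ^ Suc n)"
  unfolding ring_cong_fps_X_power_iff
proof (intro allI impI)
  fix i assume i: "i < Suc n"
  have "eventually (\<lambda>N. fps_nth (\<Prod>j\<le>N. 1 - fps_X ^ Suc j) i = fps_nth euler i) sequentially"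
    using euler_tendsto by (simp only: tendsto_fps_iff)
  moreover have "eventually (\<lambda>N. fps_nth (\<Prod>j\<le>N. 1 - fps_X ^ Suc j) i = 
                   fps_nth (qfact fps_X n :: int fps) i) sequentially"
    using eventually_ge_at_top[of n]
  proof eventually_elim
    case (elim N)
    hence "[qfact fps_X (Suc N) = (qfact fps_X n :: int fps)] (rmod fps_X ^ Suc n)"
      by (intro qfact_cong_qfact) auto
    thus ?case
      using i by (simp only: ring_cong_fps_X_power_iff qfact_def lessThan_Suc_atMost)
  qed
  ultimately have "eventually (\<lambda>N. fps_nth euler i = fps_nth (qfact fps_X n) i) sequentially"
    by eventually_elim simp
  thus "fps_nth euler i = fps_nth (qfact fps_X n) i"
    by simp
qed

lemma euler_nth_0 [simp]: "fps_nth euler 0 = 1"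
  by (rule qpochhammer_inf_nth_0) auto

text \<open>The generating function of the partition numbers.\<close>
definition partition_gf :: "int fps" where
  "partition_gf = fps_right_inverse euler 1"

lemma euler_mult_partition_gf [simp]: "euler * partition_gf = 1"
  unfolding partition_gf_def by (rule fps_right_inverse) simp

section \<open>Euler's pentagonal number theorem\<close>

lemma double_sum_atMost: "2 * \<Sum>{..n} = n * Suc n" for n :: nat
  by (induction n) auto

text \<open>
  Shanks's finite form of the pentagonal number theorem. On the left, only the summand for \<open>j = 0\<close>
  is not divisible by \<open>q\<^bsup>n+1\<^esup>\<close>, and it is \<open>(q;q)\<^sub>n\<close>. In the induction step the difference of two
  consecutive left-hand sides telescopes up to the two new pentagonal powers.
\<close>
lemma shanks_pentagonal_identity:
  fixes q :: "'a::comm_ring_1"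
  shows "(\<Sum>j\<le>n. (-1) ^ j * (\<Prod>i\<in>{j..<n}. 1 - q ^ Suc i) * q ^ (\<Sum>{..j} + j * n)) =
         (\<Sum>m = - int n..int n. (-1) ^ nat \<bar>m\<bar> * q ^ nat (m * (3 * m - 1) div 2))"
proof (induction n)
  case (Suc n)
  define T where "T = (\<lambda>n j. \<Prod>i\<in>{j..<n}. 1 - q ^ Suc i)"
  define U where "U = (\<lambda>j. case j of 0 \<Rightarrow> 0 | Suc i \<Rightarrow> (-1) ^ j * T n i * q ^ (\<Sum>{..j} + j * n))"
  define P where "P = (\<lambda>m::int. (-1) ^ nat \<bar>m\<bar> * q ^ nat (m * (3 * m - 1) div 2))"
  have T_Suc_left: "T n j = T n (Suc j) * (1 - q ^ Suc j)" if "j < n" for j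
    using that by (simp add: T_def prod.atLeast_Suc_lessThan mult.commute del: power_Suc)
  have T_Suc_right: "T (Suc n) j = T n j * (1 - q ^ Suc n)" if "j \<le> n" for j
    using that by (simp add: T_def)
  \<comment> \<open>The factor \<open>(1 - q\<^bsup>n+1\<^esup>) q\<^sup>j - 1\<close> between old and new summands is
    \<open>- (1 - q\<^sup>j) - q\<^bsup>n+1+j\<^esup>\<close>; its first part lowers \<open>j\<close> in \<open>T\<close>, the second one shifts the exponent.\<close>
  have telescope: "(-1) ^ j * T (Suc n) j * q ^ (\<Sum>{..j} + j * Suc n) =
      (-1) ^ j * T n j * q ^ (\<Sum>{..j} + j * n) + (U (Suc j) - U j)" if "j \<le> n" for j
  proof (cases j)
    case 0
    thus ?thesis
      by (simp add: T_Suc_right U_def) (simp add: algebra_simps)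
  next
    case (Suc i)
    have T_i: "T n i = T n j * (1 - q ^ j)"
      using T_Suc_left[of i] that Suc by simp
    have U_j: "U j = (-1) ^ j * T n j * (1 - q ^ j) * q ^ (\<Sum>{..j} + j * n)"
      unfolding U_def Suc using T_i Suc by (simp add: mult.assoc)
    have U_Suc_j: "U (Suc j) = - ((-1) ^ j * T n j * q ^ (\<Sum>{..j} + j * n) * (q ^ j * q ^ Suc n))"
      by (simp add: U_def algebra_simps power_add)
    have exp: "q ^ (\<Sum>{..j} + j * Suc n) = q ^ (\<Sum>{..j} + j * n) * q ^ j"
      by (simp add: algebra_simps flip: power_add)
    show ?thesis
      unfolding T_Suc_right[OF that] U_j U_Suc_j exp by (simp add: algebra_simps)
  qed
  have "(\<Sum>j\<le>n. (-1) ^ j * T (Suc n) j * q ^ (\<Sum>{..j} + j * Suc n)) =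
        (\<Sum>j\<le>n. (-1) ^ j * T n j * q ^ (\<Sum>{..j} + j * n)) + (\<Sum>j\<le>n. U (Suc j) - U j)"
    unfolding sum.distrib [symmetric] by (intro sum.cong refl telescope) simp
  also have "(\<Sum>j\<le>n. U (Suc j) - U j) = U (Suc n)"
    using sum_lessThan_telescope[of U "Suc n"] by (simp add: lessThan_Suc_atMost U_def)
  also have "U (Suc n) = P (int (Suc n))"
  proof -
    have *: "int (Suc n) * (3 * int (Suc n) - 1) = 2 * int (\<Sum>{..Suc n} + Suc n * n)"
      using arg_cong[OF double_sum_atMost[of "Suc n"], of int]
      by (simp add: algebra_simps del: sum.atMost_Suc)
    have "nat (int (Suc n) * (3 * int (Suc n) - 1) div 2) = \<Sum>{..Suc n} + Suc n * n"
      unfolding *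
      by (simp only: nonzero_mult_div_cancel_left zero_neq_numeral not_False_eq_True nat_int)
    thus ?thesis
      unfolding U_def P_def by (simp add: T_def del: sum.atMost_Suc power_Suc of_nat_Suc)
  qed
  also have "(\<Sum>j\<le>n. (-1) ^ j * T n j * q ^ (\<Sum>{..j} + j * n)) = sum P {- int n..int n}"
    using Suc.IH by (simp add: T_def P_def)
  finally have "(\<Sum>j\<le>n. (-1) ^ j * T (Suc n) j * q ^ (\<Sum>{..j} + j * Suc n)) =
                  sum P {- int n..int n} + P (int (Suc n))" .
  moreover have "(-1) ^ Suc n * q ^ (\<Sum>{..Suc n} + Suc n * Suc n) = P (- int (Suc n))"
  proof -
    have *: "(- int (Suc n)) * (3 * (- int (Suc n)) - 1) = 2 * int (\<Sum>{..Suc n} + Suc n * Suc n)"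
      using arg_cong[OF double_sum_atMost[of "Suc n"], of int]
      by (simp add: algebra_simps del: sum.atMost_Suc)
    have "nat ((- int (Suc n)) * (3 * (- int (Suc n)) - 1) div 2) = \<Sum>{..Suc n} + Suc n * Suc n"
      unfolding *
      by (simp only: nonzero_mult_div_cancel_left zero_neq_numeral not_False_eq_True nat_int)
    thus ?thesis
      unfolding P_def by (simp del: sum.atMost_Suc power_Suc of_nat_Suc)
  qed
  moreover have "{- int (Suc n)..int (Suc n)} =
                   insert (int (Suc n)) (insert (- int (Suc n)) {- int n..int n})"
    by auto
  ultimately have "(\<Sum>j\<le>Suc n. (-1) ^ j * T (Suc n) j * q ^ (\<Sum>{..j} + j * Suc n)) =
                     sum P {- int (Suc n)..int (Suc n)}"
    by (subst sum.atMost_Suc) (simp add: T_def algebra_simps del: sum.atMost_Suc power_Suc)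
  thus ?case
    by (simp only: T_def P_def)
qed simp

lemma euler_nth_sum:
  "fps_nth euler n =
     (\<Sum>m = - int n..int n. if nat (m * (3 * m - 1) div 2) = n then (-1) ^ nat \<bar>m\<bar> else 0)"
proof -
  define f :: "nat \<Rightarrow> int fps" where
    "f = (\<lambda>j. (-1) ^ j * (\<Prod>i\<in>{j..<n}. 1 - fps_X ^ Suc i) * fps_X ^ (\<Sum>{..j} + j * n))"
  have "[f j = 0] (rmod fps_X ^ Suc n)" if "j > 0" for j
  proof -
    have "j * n \<ge> n" "\<Sum>{..j} \<ge> j"
      using that by (auto intro: member_le_sum)
    hence "fps_X ^ Suc n dvd (fps_X ^ (\<Sum>{..j} + j * n) :: int fps)"
      using that by (intro le_imp_power_dvd) linarith
    thus ?thesis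
      by (simp add: ring_cong_def f_def del: power_Suc)
  qed
  hence "[sum f {..n} = (\<Sum>j\<le>n. if j = 0 then f 0 else 0)] (rmod fps_X ^ Suc n)"
    by (intro ring_cong_sum) auto
  also have "(\<Sum>j\<le>n. if j = 0 then f 0 else 0) = qfact fps_X n"
    by (simp add: f_def qfact_def atLeast0LessThan)
  finally have "[sum f {..n} = qfact fps_X n] (rmod fps_X ^ Suc n)" .
  from ring_cong_trans[OF euler_cong_qfact ring_cong_sym[OF this]]
  have "[euler = sum f {..n}] (rmod fps_X ^ Suc n)" .
  hence "fps_nth euler n = fps_nth (sum f {..n}) n"
    by (simp add: ring_cong_fps_X_power_iff del: power_Suc)
  also have "sum f {..n} =
      (\<Sum>m = - int n..int n. fps_const ((-1) ^ nat \<bar>m\<bar>) * fps_X ^ nat (m * (3 * m - 1) div 2))"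
    unfolding f_def shanks_pentagonal_identity
    by (intro sum.cong refl) (simp flip: fps_const_power fps_const_neg)
  finally show ?thesis
    by (simp add: fps_sum_nth if_distrib cong: if_cong) (auto intro!: sum.cong)
qed

text \<open>
  Completing the square; membership in the pentagonal numbers becomes a statement about squares.
\<close>
lemma pentagonal_iff:
  "nat (m * (3 * m - 1) div 2) = n \<longleftrightarrow> 24 * int n + 1 = (6 * m - 1) ^ 2"
proof -
  have "even (m * (3 * m - 1))"
    by auto
  hence "2 * (m * (3 * m - 1) div 2) = m * (3 * m - 1)"
    by (rule dvd_mult_div_cancel)
  moreover have "m * (3 * m - 1) \<ge> 0"
    by (cases "m \<ge> 1") (auto simp: zero_le_mult_iff)
  moreover have "(6 * m - 1) ^ 2 = 12 * (m * (3 * m - 1)) + 1"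
    by (simp add: power2_eq_square algebra_simps)
  ultimately show ?thesis
    by linarith
qed

lemma euler_nth_pentagonal:
  assumes "24 * int n + 1 = (6 * m - 1) ^ 2"
  shows "fps_nth euler n = (-1) ^ nat \<bar>m\<bar>"
proof -
  have unique: "m' = m" if "24 * int n + 1 = (6 * m' - 1) ^ 2" for m'
  proof -
    have "(6 * m - 1) ^ 2 = (6 * m' - 1) ^ 2"
      using assms that by simp
    hence "6 * m - 1 = 6 * m' - 1 \<or> 6 * m - 1 = - (6 * m' - 1)"
      by (simp only: power2_eq_iff)
    thus ?thesis
      by presburger
  qed
  have "12 * (m * (3 * m - 1)) = 24 * int n"
    using assms by (simp add: power2_eq_square algebra_simps)
  hence *: "m * (3 * m - 1) = 2 * int n"
    by simp
  have "m \<in> {- int n..int n}"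
  proof (cases "m \<ge> 1")
    case True
    hence "m * (3 * m - 1) \<ge> m * 2"
      by (intro mult_left_mono) auto
    thus ?thesis
      using * True by simp
  next
    case False
    have "m \<ge> - int n"
    proof (cases "m = 0")
      case m: False
      have "(- m) * (1 - 3 * m) \<ge> (- m) * 2"
        using False m by (intro mult_left_mono) auto
      moreover have "(- m) * (1 - 3 * m) = 2 * int n"
        using * by (simp add: algebra_simps)
      ultimately show ?thesis
        by linarith
    qed simp
    thus ?thesis
      using False by simp
  qed
  moreover have "24 * int n + 1 = (6 * m' - 1) ^ 2 \<longleftrightarrow> m' = m" for m'
    using unique assms by blast
  ultimately show ?thesis
    unfolding euler_nth_sum pentagonal_iff by simp
qed

lemma euler_nth_not_pentagonal:
  assumes "\<And>m. 24 * int n + 1 \<noteq> (6 * m - 1) ^ 2"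
  shows "fps_nth euler n = 0"
  unfolding euler_nth_sum pentagonal_iff using assms by simp

section \<open>Jacobi's formula for the cube of Euler's product\<close>

text \<open>The Gaussian binomial coefficients.\<close>
fun qbinom :: "'a::comm_ring_1 \<Rightarrow> nat \<Rightarrow> nat \<Rightarrow> 'a" where
  "qbinom q n 0 = 1"
| "qbinom q 0 (Suc k) = 0"
| "qbinom q (Suc n) (Suc k) = qbinom q n k + q ^ Suc k * qbinom q n (Suc k)"

lemma qbinom_eq_0 [simp]: "k > n \<Longrightarrow> qbinom q n k = 0"
  by (induction q n k rule: qbinom.induct) auto

text \<open>
  The second Pascal rule. Both rules are needed since Jacobi's sum is lifted from \<open>2 n + 1\<close> to
  \<open>2 n + 3\<close> by one application of each, which keeps it symmetric.
\<close>
lemma qbinom_Suc_Suc':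
  "k \<le> n \<Longrightarrow> qbinom q (Suc n) (Suc k) = q ^ (n - k) * qbinom q n k + qbinom q n (Suc k)"
proof (induction n arbitrary: k)
  case (Suc n)
  have "qbinom q (Suc (Suc n)) (Suc k) =
          qbinom q (Suc n) k + q ^ Suc k * qbinom q (Suc n) (Suc k)"
    by simp
  show ?case
  proof (cases "k = Suc n")
    case False
    hence k: "k \<le> n"
      using Suc.prems by simp
    show ?thesis
    proof (cases k)
      case 0
      have "qbinom q (Suc (Suc n)) 1 = 1 + q * qbinom q (Suc n) 1"
        by simp
      also have "qbinom q (Suc n) 1 = q ^ n + qbinom q n 1"
        using Suc.IH[of 0] by simp
      also have "1 + q * (q ^ n + qbinom q n 1) = q ^ Suc n + (1 + q * qbinom q n 1)"
        by (simp add: algebra_simps)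
      finally show ?thesis
        using 0 by simp
    next
      case [simp]: (Suc i)
      have IH1: "qbinom q (Suc n) k = q ^ Suc (n - k) * qbinom q n i + qbinom q n k"
        using Suc.IH[of i] k by (simp add: Suc_diff_Suc)
      have IH2: "qbinom q (Suc n) (Suc k) = q ^ (n - k) * qbinom q n k + qbinom q n (Suc k)"
        using k by (rule Suc.IH)
      have "qbinom q (Suc (Suc n)) (Suc k) =
              qbinom q (Suc n) k + q ^ Suc k * qbinom q (Suc n) (Suc k)"
        by (rule qbinom.simps)
      also have "\<dots> = q ^ Suc (n - k) * (qbinom q n i + q ^ k * qbinom q n k) +
                       (qbinom q n k + q ^ Suc k * qbinom q n (Suc k))"
        unfolding IH1 IH2 by (simp add: algebra_simps)
      also have "qbinom q n i + q ^ k * qbinom q n k = qbinom q (Suc n) k"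
        by simp
      also have "qbinom q n k + q ^ Suc k * qbinom q n (Suc k) = qbinom q (Suc n) (Suc k)"
        by simp
      also have "Suc (n - k) = Suc n - k"
        using k by (simp only: Suc_diff_le)
      finally show ?thesis .
    qed
  qed simp
qed simp

text \<open>
  A division-free form of \<open>(q;q)\<^bsub>k+l\<^esub> / ((q;q)\<^sub>k (q;q)\<^sub>l)\<close>. For large \<open>k\<close> and \<open>l\<close> it shows that
  the Gaussian binomial coefficient approaches \<open>1 / (q;q)\<^sub>\<infinity>\<close>.
\<close>
lemma qbinom_mult_qfact:
  "qbinom q (k + l) k * (qfact q k * qfact q l) = qfact q (k + l)"
proof (induction "k + l" arbitrary: k l)
  case (Suc n)
  show ?case
  proof (cases "k = 0 \<or> l = 0")
    case True
    have "qbinom q m m = 1" for m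
      by (induction m) auto
    thus ?thesis
      using True by auto
  next
    case False
    then obtain i j where [simp]: "k = Suc i" "l = Suc j"
      by (meson not0_implies_Suc)
    have 1: "qbinom q (i + Suc j) i * (qfact q i * qfact q (Suc j)) = qfact q (i + Suc j)"
      by (rule Suc.hyps(1)) (use Suc.hyps(2) in simp)
    have 2: "qbinom q (Suc i + j) (Suc i) * (qfact q (Suc i) * qfact q j) = qfact q (Suc i + j)"
      by (rule Suc.hyps(1)) (use Suc.hyps(2) in simp)
    have "qbinom q (k + l) k * (qfact q k * qfact q l) =
            qbinom q (i + Suc j) i * (qfact q i * qfact q (Suc j)) * (1 - q ^ Suc i) +
            q ^ Suc i * (qbinom q (Suc i + j) (Suc i) * (qfact q (Suc i) * qfact q j)) * (1 - q ^ Suc j)"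
      by (simp add: qfact_Suc algebra_simps)
    also have "\<dots> = qfact q (i + Suc j) * (1 - q ^ Suc i * q ^ Suc j)"
      unfolding 1 2 by (simp add: algebra_simps)
    finally show ?thesis
      by (simp add: qfact_Suc power_add mult_ac)
  qed
qed simp

lemma sum_mult_qbinom_Suc:
  "(\<Sum>k\<le>Suc n. v k * qbinom q (Suc n) k) = (\<Sum>k\<le>n. (v k * q ^ k + v (Suc k)) * qbinom q n k)"
proof -
  have "(\<Sum>k\<le>Suc n. v k * qbinom q (Suc n) k) =
          v 0 + (\<Sum>k\<le>n. v (Suc k) * q ^ Suc k * qbinom q n (Suc k)) + (\<Sum>k\<le>n. v (Suc k) * qbinom q n k)"
    by (subst sum.atMost_Suc_shift) (simp add: algebra_simps sum.distrib)
  also have "v 0 + (\<Sum>k\<le>n. v (Suc k) * q ^ Suc k * qbinom q n (Suc k)) =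
               (\<Sum>k\<le>Suc n. v k * q ^ k * qbinom q n k)"
    by (subst sum.atMost_Suc_shift) simp
  also have "\<dots> = (\<Sum>k\<le>n. v k * q ^ k * qbinom q n k)"
    by simp
  finally show ?thesis
    by (simp add: algebra_simps sum.distrib)
qed

lemma sum_mult_qbinom_Suc':
  "(\<Sum>k\<le>Suc n. v k * qbinom q (Suc n) k) =
     (\<Sum>k\<le>n. (v k + v (Suc k) * q ^ (n - k)) * qbinom q n k)"
proof -
  have "(\<Sum>k\<le>Suc n. v k * qbinom q (Suc n) k) =
          v 0 + (\<Sum>k\<le>n. v (Suc k) * qbinom q (Suc n) (Suc k))"
    by (subst sum.atMost_Suc_shift) simp
  also have "(\<Sum>k\<le>n. v (Suc k) * qbinom q (Suc n) (Suc k)) =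
               (\<Sum>k\<le>n. v (Suc k) * qbinom q n (Suc k)) + (\<Sum>k\<le>n. v (Suc k) * q ^ (n - k) * qbinom q n k)"
    by (subst sum.distrib [symmetric], intro sum.cong refl, subst qbinom_Suc_Suc')
       (simp_all add: algebra_simps)
  also have "v 0 + ((\<Sum>k\<le>n. v (Suc k) * qbinom q n (Suc k)) +
                      (\<Sum>k\<le>n. v (Suc k) * q ^ (n - k) * qbinom q n k)) =
               (\<Sum>k\<le>Suc n. v k * qbinom q n k) + (\<Sum>k\<le>n. v (Suc k) * q ^ (n - k) * qbinom q n k)"
    by (subst sum.atMost_Suc_shift) simp
  also have "(\<Sum>k\<le>Suc n. v k * qbinom q n k) = (\<Sum>k\<le>n. v k * qbinom q n k)"
    by simp
  finally show ?thesis
    by (simp add: algebra_simps sum.distrib)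
qed

text \<open>
  The summand of Jacobi's series, for every integer index. It takes the same value at \<open>j\<close> and
  \<open>- 1 - j\<close>, so that the sum over all integers is twice Jacobi's sum over the natural numbers; this
  explains the factor 2 below.
\<close>
definition jacobi_term :: "'a::comm_ring_1 \<Rightarrow> int \<Rightarrow> 'a" where
  "jacobi_term q j = (-1) ^ nat \<bar>j\<bar> * of_int (2 * j + 1) * q ^ nat (j * (j + 1) div 2)"

lemma minus_one_power_nat_abs: "(-1::'a::comm_ring_1) ^ nat \<bar>j\<bar> = (if even j then 1 else -1)"
  by (simp add: minus_one_power_iff even_nat_iff)

lemma int_triangular_nonneg: "(j::int) * (j + 1) div 2 \<ge> 0"
  by (cases "j \<ge> 0") (auto simp: pos_imp_zdiv_nonneg_iff mult_nonpos_nonpos)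

text \<open>
  The left-hand side is the coefficient that the Pascal rules produce. Without the powers of \<open>q\<close>
  that the triangular numbers absorb, the identity says that \<open>(2j - 1) + (2j + 3) = 2 (2j + 1)\<close>.
\<close>
lemma jacobi_term_recurrence:
  fixes j :: int
  assumes "- 1 - int n \<le> j" "j \<le> int n"
  shows "jacobi_term q (j - 1) * q ^ nat (int n + 1 + j) + jacobi_term q (j + 1) * q ^ nat (int n - j) +
           (1 + q ^ (2 * n + 2)) * jacobi_term q j = (1 - q ^ Suc n) ^ 2 * jacobi_term q j"
proof -
  let ?t = "\<lambda>j::int. j * (j + 1) div 2"
  have "?t j = ?t (j - 1) + j"
    by (simp add: algebra_simps)
  hence "nat (?t (j - 1)) + nat (int n + 1 + j) = nat (?t j) + Suc n"
    using assms int_triangular_nonneg[of "j - 1"] int_triangular_nonneg[of j] by simp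
  hence e1: "q ^ nat (?t (j - 1)) * q ^ nat (int n + 1 + j) = q ^ nat (?t j) * q ^ Suc n"
    by (simp only: flip: power_add)
  have "(j + 1) * (j + 2) = j * (j + 1) + 2 * (j + 1)"
    by (simp add: algebra_simps)
  hence "(j + 1) * (j + 1 + 1) div 2 = (j * (j + 1) + 2 * (j + 1)) div 2"
    by (simp add: add.assoc)
  also have "\<dots> = ?t j + (j + 1)"
    by (simp only: div_mult_self2 zero_neq_numeral not_False_eq_True)
  finally have "?t (j + 1) = ?t j + (j + 1)" .
  hence "nat (?t (j + 1)) + nat (int n - j) = nat (?t j) + Suc n"
    using assms int_triangular_nonneg[of "j + 1"] int_triangular_nonneg[of j] by simp
  hence e2: "q ^ nat (?t (j + 1)) * q ^ nat (int n - j) = q ^ nat (?t j) * q ^ Suc n"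
    by (simp only: flip: power_add)
  define s where "s = ((-1) ^ nat \<bar>j\<bar> :: 'a)"
  have t1: "jacobi_term q (j - 1) * q ^ nat (int n + 1 + j) =
          - s * of_int (2 * j - 1) * (q ^ nat (?t (j - 1)) * q ^ nat (int n + 1 + j))"
    by (simp add: jacobi_term_def s_def minus_one_power_nat_abs algebra_simps)
  have t2: "jacobi_term q (j + 1) * q ^ nat (int n - j) =
          - s * of_int (2 * j + 3) * (q ^ nat (?t (j + 1)) * q ^ nat (int n - j))"
    by (simp add: jacobi_term_def s_def minus_one_power_nat_abs algebra_simps)
  have t3: "jacobi_term q j = s * of_int (2 * j + 1) * q ^ nat (?t j)"
    by (simp add: jacobi_term_def s_def)
  have t4: "q ^ (2 * n + 2) = q ^ Suc n * q ^ Suc n"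
    by (simp add: mult_2 power_add)
  show ?thesis
    unfolding t1 t2 t3 t4 e1 e2 by (simp add: power2_eq_square algebra_simps)
qed

text \<open>
  A finite form of Jacobi's formula for \<open>(q;q)\<^sub>\<infinity>\<^sup>3\<close>: by the recurrence for the summands, raising \<open>n\<close> by one
  multiplies the sum by \<open>(1 - q\<^bsup>n+1\<^esup>)\<^sup>2\<close>.
\<close>
lemma finite_jacobi_identity:
  "(\<Sum>k\<le>2 * n + 1. jacobi_term q (int n - int k) * qbinom q (2 * n + 1) k) = 2 * qfact q n ^ 2"
proof (induction n)
  case 0
  show ?case
    by (simp add: jacobi_term_def)
next
  case (Suc n)
  have index: "2 * Suc n + 1 = Suc (Suc (2 * n + 1))"
    by simp
  define v where "v = (\<lambda>k. jacobi_term q (int (Suc n) - int k))"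
  have "(\<Sum>k\<le>2 * Suc n + 1. v k * qbinom q (2 * Suc n + 1) k) =
        (\<Sum>k\<le>Suc (Suc (2 * n + 1)). v k * qbinom q (Suc (Suc (2 * n + 1))) k)"
    by (simp only: index)
  also have "\<dots> = (\<Sum>k\<le>2 * n + 1.
      (v k * q ^ k + v (Suc k) +
        (v (Suc k) * q ^ Suc k + v (Suc (Suc k))) * q ^ (2 * n + 1 - k)) * qbinom q (2 * n + 1) k)"
    by (simp only: sum_mult_qbinom_Suc[where n = "Suc (2 * n + 1)"]
                   sum_mult_qbinom_Suc'[where n = "2 * n + 1"])
  also have "\<dots> = (\<Sum>k\<le>2 * n + 1.
      (1 - q ^ Suc n) ^ 2 * (jacobi_term q (int n - int k) * qbinom q (2 * n + 1) k))"
  proof (rule sum.cong)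
    fix k assume "k \<in> {..2 * n + 1}"
    hence k: "k \<le> 2 * n + 1"
      by simp
    define j where "j = int n - int k"
    have j: "- 1 - int n \<le> j" "j \<le> int n"
      using k by (auto simp: j_def)
    have exps: "nat (int n + 1 + j) = 2 * n + 1 - k" "nat (int n - j) = k"
      using k by (simp_all add: j_def)
    have pow: "q ^ Suc k * q ^ (2 * n + 1 - k) = q ^ (2 * n + 2)"
      using k by (simp flip: power_add power_Suc)
    have "v k = jacobi_term q (j + 1)" "v (Suc k) = jacobi_term q j" "v (Suc (Suc k)) = jacobi_term q (j - 1)"
      by (simp_all add: v_def j_def algebra_simps)
    hence "v k * q ^ k + v (Suc k) + (v (Suc k) * q ^ Suc k + v (Suc (Suc k))) * q ^ (2 * n + 1 - k) =
           jacobi_term q (j - 1) * q ^ (2 * n + 1 - k) + jacobi_term q (j + 1) * q ^ k + 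
             (1 + q ^ Suc k * q ^ (2 * n + 1 - k)) * jacobi_term q j"
      by (simp add: algebra_simps)
    also have "\<dots> = (1 - q ^ Suc n) ^ 2 * jacobi_term q j"
      using jacobi_term_recurrence[OF j, of q] unfolding exps pow .
    finally show "(v k * q ^ k + v (Suc k) +
          (v (Suc k) * q ^ Suc k + v (Suc (Suc k))) * q ^ (2 * n + 1 - k)) * qbinom q (2 * n + 1) k =
        (1 - q ^ Suc n) ^ 2 * (jacobi_term q (int n - int k) * qbinom q (2 * n + 1) k)"
      by (simp only: j_def mult.assoc)
  qed simp
  also have "\<dots> = (1 - q ^ Suc n) ^ 2 * (2 * qfact q n ^ 2)"
    by (simp only: Suc.IH flip: sum_distrib_left)
  also have "\<dots> = 2 * qfact q (Suc n) ^ 2"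
    by (simp only: qfact_Suc power_mult_distrib mult_ac)
  finally show ?case
    by (simp only: v_def)
qed

lemma jacobi_term_fps_X:
  "jacobi_term fps_X j =
     fps_const ((-1) ^ nat \<bar>j\<bar> * (2 * j + 1)) * (fps_X ^ nat (j * (j + 1) div 2) :: int fps)"
proof -
  have "((-1) ^ nat \<bar>j\<bar> :: int fps) = fps_const ((-1) ^ nat \<bar>j\<bar>)"
    by (simp add: minus_one_power_nat_abs)
  moreover have "(of_int (2 * j + 1) :: int fps) = fps_const (2 * j + 1)"
    by (simp flip: fps_of_int)
  ultimately show ?thesis
    by (simp only: jacobi_term_def fps_const_mult)
qed

text \<open>
  The limit of the finite identity, up to order \<open>N\<close> and multiplied by Euler's product. The choice
  \<open>n = 2 N + 1\<close> ensures that each \<open>k\<close> falls under one of two cases: either both \<open>k\<close> and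
  \<open>2 n + 1 - k\<close> are at least \<open>N\<close>, so that the binomial coefficient agrees with \<open>1 / (q;q)\<^sub>\<infinity>\<close>, or
  the triangular exponent of the summand exceeds \<open>N\<close>.
\<close>
lemma two_euler_cube_cong:
  fixes N :: nat
  defines "n \<equiv> 2 * N + 1"
  shows "[2 * euler ^ 3 = (\<Sum>k\<le>2 * n + 1. jacobi_term fps_X (int n - int k))] (rmod fps_X ^ Suc N)"
proof -
  have term_cong: "[euler * (jacobi_term fps_X (int n - int k) * qbinom fps_X (2 * n + 1) k) =
                 jacobi_term fps_X (int n - int k)] (rmod fps_X ^ Suc N)"
    if k: "k \<le> 2 * n + 1" for k
  proof (cases "k \<ge> N \<and> 2 * n + 1 - k \<ge> N")
    case True
    define l where "l = 2 * n + 1 - k"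
    let ?B = "qbinom fps_X (2 * n + 1) k :: int fps"
    have kl: "k + l = 2 * n + 1" "l \<ge> N" "k \<ge> N"
      using k True by (auto simp: l_def)
    have qfact_cong: "[qfact fps_X m = euler] (rmod fps_X ^ Suc N)" if "m \<ge> N" for m
      by (rule ring_cong_trans[OF qfact_cong_qfact[OF that] ring_cong_sym[OF euler_cong_qfact]])
    have "[?B * (euler * euler) = ?B * (qfact fps_X k * qfact fps_X l)] (rmod fps_X ^ Suc N)"
      using kl by (intro ring_cong_mult ring_cong_refl) (rule ring_cong_sym, rule qfact_cong, simp)+
    also have "?B * (qfact fps_X k * qfact fps_X l) = qfact fps_X (2 * n + 1)"
      using qbinom_mult_qfact[of "fps_X :: int fps" k l] unfolding kl .
    also have "[qfact fps_X (2 * n + 1) = euler] (rmod fps_X ^ Suc N)"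
      by (rule qfact_cong) (simp add: n_def)
    finally have "[?B * (euler * euler) = euler] (rmod fps_X ^ Suc N)" .
    from ring_cong_mult[OF this ring_cong_refl, of partition_gf]
    have "[?B * euler * (euler * partition_gf) = euler * partition_gf] (rmod fps_X ^ Suc N)"
      by (simp only: mult_ac)
    hence "[?B * euler = 1] (rmod fps_X ^ Suc N)"
      by simp
    from ring_cong_mult[OF ring_cong_refl this, of "jacobi_term fps_X (int n - int k)"]
    show ?thesis
      by (simp only: mult_ac mult_1_left)
  next
    case False
    define j where "j = int n - int k"
    have "int N + 1 \<le> j * (j + 1) div 2"
    proof -
      consider "j \<ge> int N + 2" | "j \<le> - int N - 3"
        using False k by (auto simp: j_def n_def)
      hence "j * (j + 1) \<ge> (int N + 2) * 2"
      proof cases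
        case 1
        thus ?thesis by (intro mult_mono) auto
      next
        case 2
        hence "(- j) * (- (j + 1)) \<ge> (int N + 2) * 2"
          by (intro mult_mono) auto
        thus ?thesis
          by (simp only: minus_mult_minus)
      qed
      thus ?thesis by simp
    qed
    hence "fps_X ^ Suc N dvd (fps_X ^ nat (j * (j + 1) div 2) :: int fps)"
      by (intro le_imp_power_dvd) linarith
    hence "fps_X ^ Suc N dvd (jacobi_term fps_X j :: int fps)"
      unfolding jacobi_term_def by (rule dvd_mult)
    hence *: "[jacobi_term fps_X j = (0 :: int fps)] (rmod fps_X ^ Suc N)"
      by (simp add: ring_cong_def)
    have "[euler * (jacobi_term fps_X j * qbinom fps_X (2 * n + 1) k) =
           euler * (0 * qbinom fps_X (2 * n + 1) k)] (rmod fps_X ^ Suc N)"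
      by (intro ring_cong_mult ring_cong_refl *)
    hence "[euler * (jacobi_term fps_X j * qbinom fps_X (2 * n + 1) k) = 0] (rmod fps_X ^ Suc N)"
      by (simp only: mult_zero_left mult_zero_right)
    from ring_cong_trans[OF this ring_cong_sym[OF *]] show ?thesis
      by (simp only: j_def)
  qed
  have "[qfact fps_X n = (qfact fps_X N :: int fps)] (rmod fps_X ^ Suc N)"
    by (rule qfact_cong_qfact) (simp add: n_def)
  from ring_cong_trans[OF euler_cong_qfact ring_cong_sym[OF this]]
  have "[euler = qfact fps_X n] (rmod fps_X ^ Suc N)" .
  hence "[euler * (2 * euler ^ 2) = euler * (2 * qfact fps_X n ^ 2)] (rmod fps_X ^ Suc N)"
    by (intro ring_cong_mult ring_cong_power ring_cong_refl)
  also have "euler * (2 * qfact fps_X n ^ 2) =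
     (\<Sum>k\<le>2 * n + 1. euler * (jacobi_term fps_X (int n - int k) * qbinom fps_X (2 * n + 1) k))"
    by (simp only: finite_jacobi_identity [symmetric] sum_distrib_left)
  also have "[(\<Sum>k\<le>2 * n + 1. euler * (jacobi_term fps_X (int n - int k) * qbinom fps_X (2 * n + 1) k)) =
              (\<Sum>k\<le>2 * n + 1. jacobi_term fps_X (int n - int k))] (rmod fps_X ^ Suc N)"
    by (intro ring_cong_sum term_cong) simp
  finally show ?thesis
    by (simp add: power3_eq_cube power2_eq_square mult_ac)
qed

lemma triangular_iff: "nat (j * (j + 1) div 2) = n \<longleftrightarrow> 8 * int n + 1 = (2 * j + 1) ^ 2"
proof -
  have "even (j * (j + 1))"
    by auto
  hence "2 * (j * (j + 1) div 2) = j * (j + 1)"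
    by (rule dvd_mult_div_cancel)
  moreover have "(2 * j + 1) ^ 2 = 4 * (j * (j + 1)) + 1"
    by (simp add: power2_eq_square algebra_simps)
  ultimately show ?thesis
    using int_triangular_nonneg[of j] by linarith
qed

text \<open>
  Jacobi's identity is \<open>(q;q)\<^sub>\<infinity>\<^sup>3 = \<Sum>\<^sub>j\<^sub>\<ge>\<^sub>0 (-1)\<^sup>j (2j+1) q\<^bsup>j(j+1)/2\<^esup>\<close>. The congruences only use
  its support and the divisibility of the coefficients by \<open>y = 2j+1\<close>.
\<close>
lemma euler_cube_nth:
  assumes "fps_nth (euler ^ 3) n \<noteq> 0"
  obtains y where "8 * int n + 1 = y ^ 2" "y dvd fps_nth (euler ^ 3) n"
proof -
  define M where "M = 2 * n + 1"
  define t where "t = (\<lambda>j. fps_nth (jacobi_term fps_X j :: int fps) n)"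
  have t: "t j = (if 8 * int n + 1 = (2 * j + 1) ^ 2 then (-1) ^ nat \<bar>j\<bar> * (2 * j + 1) else 0)" for j
    unfolding t_def jacobi_term_fps_X triangular_iff [symmetric] by auto
  have "fps_nth (2 * euler ^ 3) n = fps_nth (\<Sum>k\<le>2 * M + 1. jacobi_term fps_X (int M - int k)) n"
    using two_euler_cube_cong[of n] unfolding ring_cong_fps_X_power_iff M_def by blast
  moreover have "fps_nth (2 * euler ^ 3) n = 2 * fps_nth (euler ^ 3) n"
    by (simp add: numeral_fps_const)
  ultimately have sum: "2 * fps_nth (euler ^ 3) n = (\<Sum>k\<le>2 * M + 1. t (int M - int k))"
    by (simp add: t_def fps_sum_nth)
  with assms have "(\<Sum>k\<le>2 * M + 1. t (int M - int k)) \<noteq> 0"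
    by simp
  then obtain k where "t (int M - int k) \<noteq> 0"
    by (meson sum.neutral)
  then obtain j where j: "8 * int n + 1 = (2 * j + 1) ^ 2"
    unfolding t by metis
  \<comment> \<open>All the indices that contribute have the same \<open>2 i + 1\<close> up to sign, hence the sum need not be
    evaluated: it is divisible by \<open>2 j + 1\<close>, and so is its half since \<open>2 j + 1\<close> is odd.\<close>
  have "(2 * j + 1) dvd t i" for i
  proof (cases "8 * int n + 1 = (2 * i + 1) ^ 2")
    case True
    hence "(2 * i + 1) ^ 2 = (2 * j + 1) ^ 2"
      using j by (simp only:)
    hence "2 * i + 1 = 2 * j + 1 \<or> 2 * i + 1 = - (2 * j + 1)"
      by (simp only: power2_eq_iff)
    hence "(2 * j + 1) dvd (2 * i + 1)"
      by (metis dvd_refl dvd_minus_iff)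
    thus ?thesis
      using True by (simp add: t)
  qed (simp add: t)
  hence "(2 * j + 1) dvd 2 * fps_nth (euler ^ 3) n"
    unfolding sum by (intro dvd_sum)
  moreover have "coprime (2 * j + 1) 2"
    by simp
  ultimately have "(2 * j + 1) dvd fps_nth (euler ^ 3) n"
    by (simp only: coprime_dvd_mult_right_iff)
  with j show ?thesis
    using that by blast
qed

section \<open>Ramanujan's congruences modulo 5 and 7\<close>

lemma euler_nth_nonzero_imp_square:
  assumes "fps_nth euler n \<noteq> 0"
  obtains x where "24 * int n + 1 = x ^ 2"
  using assms euler_nth_not_pentagonal by metis

text \<open>
  The reason is that \<open>-3\<close> is not a square modulo 5.
\<close>
lemma five_dvd_sum_imp_dvd:
  fixes x y :: int
  assumes "5 dvd x ^ 2 + 3 * y ^ 2"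
  shows "5 dvd y"
proof -
  have residue: "z mod 5 \<in> {0..4}" for z :: int
    using pos_mod_bound[of 5 z] by simp
  have cases: "\<forall>u\<in>{0..4}. \<forall>v\<in>{0..4}. (u ^ 2 + 3 * v ^ 2) mod 5 = (0::int) \<longrightarrow> v = 0"
    by (simp add: simp_from_to)
  have "[(x mod 5) ^ 2 + 3 * (y mod 5) ^ 2 = x ^ 2 + 3 * y ^ 2] (mod 5)"
    by (intro cong_add cong_mult cong_pow cong_refl) (simp_all add: cong_def)
  hence "((x mod 5) ^ 2 + 3 * (y mod 5) ^ 2) mod 5 = 0"
    using assms by (simp only: cong_def dvd_eq_mod_eq_0)
  hence "y mod 5 = 0"
    by (rule cases[rule_format, OF residue residue])
  thus ?thesis
    by (simp only: dvd_eq_mod_eq_0)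
qed

text \<open>
  The reason is that \<open>-1\<close> is not a square modulo 7.
\<close>
lemma seven_dvd_sum_imp_dvd:
  fixes x y :: int
  assumes "7 dvd x ^ 2 + y ^ 2"
  shows "7 dvd y"
proof -
  have residue: "z mod 7 \<in> {0..6}" for z :: int
    using pos_mod_bound[of 7 z] by simp
  have cases: "\<forall>u\<in>{0..6}. \<forall>v\<in>{0..6}. (u ^ 2 + v ^ 2) mod 7 = (0::int) \<longrightarrow> v = 0"
    by (simp add: simp_from_to)
  have "[(x mod 7) ^ 2 + (y mod 7) ^ 2 = x ^ 2 + y ^ 2] (mod 7)"
    by (intro cong_add cong_mult cong_pow cong_refl) (simp_all add: cong_def)
  hence "((x mod 7) ^ 2 + (y mod 7) ^ 2) mod 7 = 0"
    using assms by (simp only: cong_def dvd_eq_mod_eq_0)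
  hence "y mod 7 = 0"
    by (rule cases[rule_format, OF residue residue])
  thus ?thesis
    by (simp only: dvd_eq_mod_eq_0)
qed

lemma five_dvd_euler_power_4: "5 dvd fps_nth (euler ^ 4) (5 * n + 4)"
proof -
  let ?N = "5 * n + 4"
  have split: "euler ^ 4 = euler * euler ^ 3"
    by (simp add: eval_nat_numeral)
  have terms: "5 dvd fps_nth euler i * fps_nth (euler ^ 3) (?N - i)" if "i \<le> ?N" for i
  proof (cases "fps_nth euler i = 0 \<or> fps_nth (euler ^ 3) (?N - i) = 0")
    case False
    then obtain x y where xy: "24 * int i + 1 = x ^ 2" "8 * int (?N - i) + 1 = y ^ 2"
      "y dvd fps_nth (euler ^ 3) (?N - i)"
      using euler_nth_nonzero_imp_square euler_cube_nth by metis
    have "x ^ 2 + 3 * y ^ 2 = 5 * (24 * int n + 20)"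
      unfolding xy(1,2) [symmetric] using that by (simp add: of_nat_diff)
    hence "5 dvd x ^ 2 + 3 * y ^ 2"
      by simp
    hence "5 dvd y"
      by (rule five_dvd_sum_imp_dvd)
    from dvd_trans[OF this xy(3)] show ?thesis
      by (rule dvd_mult)
  qed auto
  show ?thesis
    unfolding split fps_mult_nth by (intro dvd_sum terms) simp
qed

lemma seven_dvd_euler_power_6: "7 dvd fps_nth (euler ^ 6) (7 * n + 5)"
proof -
  let ?N = "7 * n + 5"
  have split: "euler ^ 6 = euler ^ 3 * euler ^ 3"
    by (simp flip: power_add)
  have terms: "7 dvd fps_nth (euler ^ 3) i * fps_nth (euler ^ 3) (?N - i)" if "i \<le> ?N" for i
  proof (cases "fps_nth (euler ^ 3) i = 0 \<or> fps_nth (euler ^ 3) (?N - i) = 0")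
    case False
    then obtain x y where xy: "8 * int i + 1 = x ^ 2" "8 * int (?N - i) + 1 = y ^ 2"
      "y dvd fps_nth (euler ^ 3) (?N - i)"
      using euler_cube_nth by metis
    have "x ^ 2 + y ^ 2 = 7 * (8 * int n + 6)"
      unfolding xy(1,2) [symmetric] using that by (simp add: of_nat_diff)
    hence "7 dvd x ^ 2 + y ^ 2"
      by simp
    hence "7 dvd y"
      by (rule seven_dvd_sum_imp_dvd)
    from dvd_trans[OF this xy(3)] show ?thesis
      by (rule dvd_mult)
  qed auto
  show ?thesis
    unfolding split fps_mult_nth by (intro dvd_sum terms) simp
qed

section \<open>Ramanujan's congruence modulo 11\<close>

definition residue_part :: "nat \<Rightarrow> nat \<Rightarrow> 'a::comm_ring_1 fps \<Rightarrow> 'a fps" where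
  "residue_part m r f = Abs_fps (\<lambda>n. if n mod m = r then fps_nth f n else 0)"

lemma residue_part_nth [simp]:
  "fps_nth (residue_part m r f) n = (if n mod m = r then fps_nth f n else 0)"
  by (simp add: residue_part_def)

lemma residue_part_mult:
  assumes "m > 0" "r < m"
  shows "residue_part m r (f * g) =
           (\<Sum>s<m. residue_part m s f * residue_part m ((r + (m - s)) mod m) g)"
proof (rule fps_ext)
  fix n
  have residues: "(n - i) mod m = (r + (m - i mod m)) mod m \<longleftrightarrow> n mod m = r" if "i \<le> n" for i
  proof -
    have "i mod m \<le> m"
      using assms by (simp add: less_imp_le)
    have "[n - i = r + (m - i mod m)] (mod m) \<longleftrightarrow>
          [n - i + i mod m = r + (m - i mod m) + i mod m] (mod m)"
      by (simp only: cong_add_rcancel_nat)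
    also have "r + (m - i mod m) + i mod m = r + m"
      using \<open>i mod m \<le> m\<close> by simp
    also have "[n - i + i mod m = r + m] (mod m) \<longleftrightarrow> n mod m = r"
      using assms mod_add_right_eq[of "n - i" i m] that by (simp add: cong_def del: mod_add_right_eq)
    finally show ?thesis
      by (simp add: cong_def)
  qed
  have "fps_nth (\<Sum>s<m. residue_part m s f * residue_part m ((r + (m - s)) mod m) g) n =
        (\<Sum>s<m. \<Sum>i=0..n. (if i mod m = s then fps_nth f i else 0) *
           (if (n - i) mod m = (r + (m - s)) mod m then fps_nth g (n - i) else 0))"
    by (simp add: fps_sum_nth fps_mult_nth)
  also have "\<dots> = (\<Sum>i=0..n. \<Sum>s<m. if s = i mod m then fps_nth f i *
           (if (n - i) mod m = (r + (m - s)) mod m then fps_nth g (n - i) else 0) else 0)"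
    by (subst sum.swap) (intro sum.cong refl, auto)
  also have "\<dots> = (\<Sum>i=0..n. fps_nth f i *
           (if (n - i) mod m = (r + (m - i mod m)) mod m then fps_nth g (n - i) else 0))"
    using assms by (intro sum.cong refl)
      (simp only: sum.delta finite_lessThan lessThan_iff mod_less_divisor if_True)
  also have "\<dots> = (\<Sum>i=0..n. if n mod m = r then fps_nth f i * fps_nth g (n - i) else 0)"
    by (intro sum.cong refl, subst residues) auto
  also have "\<dots> = fps_nth (residue_part m r (f * g)) n"
    by (simp add: fps_mult_nth)
  finally show "fps_nth (residue_part m r (f * g)) n =
      fps_nth (\<Sum>s<m. residue_part m s f * residue_part m ((r + (m - s)) mod m) g) n" ..
qed

text \<open>
  All exponents of \<open>g(q\<^sup>m)\<close> are divisible by \<open>m\<close>, so multiplication by it preserves residues.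
\<close>
lemma residue_part_mult_compose:
  "residue_part m r (f * (g oo fps_X ^ m)) = residue_part m r f * (g oo fps_X ^ m)"
proof (rule fps_ext)
  fix n
  have "n mod m = i mod m" if "i \<le> n" "m dvd n - i" for i
    using that by (metis mod_eq_dvd_iff_nat)
  thus "fps_nth (residue_part m r (f * (g oo fps_X ^ m))) n =
          fps_nth (residue_part m r f * (g oo fps_X ^ m)) n"
    by (auto simp: fps_mult_nth fps_nth_compose_X_power intro!: sum.cong sum.neutral)
qed

lemma residue_part_cong:
  "[f = g] (rmod fps_const c) \<Longrightarrow> [residue_part m r f = residue_part m r g] (rmod fps_const c)"
  by (simp add: ring_cong_fps_const_iff)

lemma residue_part_11_mult:
  assumes "r < 11"
  shows "residue_part 11 r (f * g) = (\<Sum>s\<in>{0, 1, 2, 3, 4, 5, 6, 7, 8, 9, 10}.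
           residue_part 11 s f * residue_part 11 ((r + (11 - s)) mod 11) g)"
proof -
  have "{..<11::nat} = {0, 1, 2, 3, 4, 5, 6, 7, 8, 9, 10}"
    by (simp add: eval_nat_numeral lessThan_Suc insert_commute)
  thus ?thesis
    using residue_part_mult[of 11 r f g] assms by simp
qed

text \<open>
  Let \<open>a, b, c, d, e\<close> be the parts of \<open>J\<close> with exponents congruent to 0, 1, 3, 6 and 10. The parts of
  \<open>J\<^sup>4\<close> for the residues 3, 6, 8, 9 and 10 are quartic forms in them, and the part of \<open>J\<^sup>7\<close> for the
  residue 6 is a form of degree 7. Comparing residues, the multiplier of the part of \<open>J\<^sup>4\<close> for the
  residue \<open>t\<close> is a combination of the cubic monomials of residue \<open>6 - t\<close>. There are three of these
  for each \<open>t\<close>, and their fifteen coefficients solve a system of linear equations modulo 11. The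
  last summand is what remains over the integers.
\<close>
lemma residue_part_power_7_in_ideal:
  fixes J :: "'a::idom fps"
  assumes "\<And>r. r \<in> {2, 4, 5, 7, 8, 9} \<Longrightarrow> residue_part 11 r J = 0"
  shows "\<exists>M3 M6 M8 M9 M10 H. residue_part 11 6 (J ^ 7) =
           residue_part 11 3 (J ^ 4) * M3 + residue_part 11 6 (J ^ 4) * M6 +
           residue_part 11 8 (J ^ 4) * M8 + residue_part 11 9 (J ^ 4) * M9 +
           residue_part 11 10 (J ^ 4) * M10 + 11 * H"
proof -
  define a b c d e where "a = residue_part 11 0 J" and "b = residue_part 11 1 J"
    and "c = residue_part 11 3 J" and "d = residue_part 11 6 J" and "e = residue_part 11 10 J"
  have zero: "residue_part 11 2 J = 0" "residue_part 11 4 J = 0" "residue_part 11 5 J = 0"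
    "residue_part 11 7 J = 0" "residue_part 11 8 J = 0" "residue_part 11 9 J = 0"
    by (simp_all add: assms)
  note J = a_def [symmetric] b_def [symmetric, simplified] c_def [symmetric] d_def [symmetric]
    e_def [symmetric] zero
  define J2 J3 J4 where "J2 = J * J" and "J3 = J2 * J" and "J4 = J2 * J2"
  have parts_J2: "residue_part 11 0 J2 = a ^ 2 + 2 * b * e"
    "residue_part 11 (Suc 0) J2 = 2 * a * b + d ^ 2"
    "residue_part 11 2 J2 = b ^ 2 + 2 * c * e"
    "residue_part 11 3 J2 = 2 * a * c"
    "residue_part 11 4 J2 = 2 * b * c"
    "residue_part 11 5 J2 = 2 * d * e"
    "residue_part 11 6 J2 = 2 * a * d + c ^ 2"
    "residue_part 11 7 J2 = 2 * b * d"
    "residue_part 11 8 J2 = 0"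
    "residue_part 11 9 J2 = 2 * c * d + e ^ 2"
    "residue_part 11 10 J2 = 2 * a * e"
    unfolding J2_def power2_eq_square by (simp_all add: residue_part_11_mult J flip: numeral_2_eq_2)
  have R: "residue_part 11 3 J4 =
          4 * a ^ 3 * c + 4 * a * b ^ 3 + 24 * a * b * c * e + 6 * b ^ 2 * d ^ 2 +
          12 * c * d ^ 2 * e + 4 * d * e ^ 3"
    "residue_part 11 6 J4 =
          4 * a ^ 3 * d + 6 * a ^ 2 * c ^ 2 + 24 * a * b * d * e + 4 * b ^ 3 * c +
          12 * b * c ^ 2 * e + 4 * d ^ 3 * e"
    "residue_part 11 8 J4 =
          12 * a * b ^ 2 * d + 24 * a * c * d * e + 4 * a * e ^ 3 + 6 * b ^ 2 * c ^ 2 +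
          4 * b * d ^ 3 + 4 * c ^ 3 * e"
    "residue_part 11 9 J4 =
          12 * a ^ 2 * c * d + 6 * a ^ 2 * e ^ 2 + 4 * a * c ^ 3 + 4 * b ^ 3 * d +
          24 * b * c * d * e + 4 * b * e ^ 3"
    "residue_part 11 10 J4 =
          4 * a ^ 3 * e + 24 * a * b * c * d + 12 * a * b * e ^ 2 + 4 * b * c ^ 3 +
          4 * c * d ^ 3 + 6 * d ^ 2 * e ^ 2"
    unfolding J4_def
    by (simp_all add: residue_part_11_mult parts_J2 flip: numeral_2_eq_2,
        simp_all add: algebra_simps eval_nat_numeral)
  have "residue_part 11 6 (J4 * J3) =
          residue_part 11 3 J4 * (4 * a ^ 2 * c - b ^ 3 - b * c * e) +
          residue_part 11 6 J4 * (4 * d ^ 2 * e - a ^ 3 - a * b * e) +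
          residue_part 11 8 J4 * (4 * a * e ^ 2 - a * c * d - c ^ 3) +
          residue_part 11 9 J4 * (4 * b ^ 2 * d - c * d * e - e ^ 3) +
          residue_part 11 10 J4 * (4 * b * c ^ 2 - a * b * d - d ^ 3) +
          11 * (a ^ 6 * d + a ^ 5 * c ^ 2 + 22 * a ^ 4 * b * d * e + 12 * a ^ 3 * b ^ 3 * c +
          30 * a ^ 3 * b * c ^ 2 * e + 12 * a ^ 3 * d ^ 3 * e + 54 * a ^ 2 * b ^ 2 * c * d ^ 2 +
          54 * a ^ 2 * b ^ 2 * d * e ^ 2 + 54 * a ^ 2 * c ^ 2 * d ^ 2 * e +
          30 * a ^ 2 * c * d * e ^ 3 + a ^ 2 * e ^ 5 + a * b ^ 6 + 22 * a * b ^ 4 * c * e +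
          30 * a * b ^ 2 * c ^ 3 * d + 54 * a * b ^ 2 * c ^ 2 * e ^ 2 + 22 * a * b * c * d ^ 4 +
          30 * a * b * d ^ 3 * e ^ 2 + 22 * a * c ^ 4 * d * e + 12 * a * c ^ 3 * e ^ 3 +
          b ^ 5 * d ^ 2 + 30 * b ^ 3 * c * d ^ 2 * e + 12 * b ^ 3 * d * e ^ 3 + b ^ 2 * c ^ 5 +
          12 * b * c ^ 3 * d ^ 3 + 54 * b * c ^ 2 * d ^ 2 * e ^ 2 + 22 * b * c * d * e ^ 4 +
          b * e ^ 6 + c ^ 6 * e + c * d ^ 6 + d ^ 5 * e ^ 2)"
    unfolding R
    by (simp add: residue_part_11_mult J3_def J4_def parts_J2 J flip: numeral_2_eq_2,
        simp add: algebra_simps eval_nat_numeral)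
  moreover have "J4 = J ^ 4" "J4 * J3 = J ^ 7"
    by (simp_all add: J2_def J3_def J4_def eval_nat_numeral mult_ac)
  ultimately show ?thesis
    by metis
qed

lemma square_mod_11:
  fixes x :: int
  shows "x ^ 2 mod 11 \<in> {0, 1, 3, 4, 5, 9}"
proof -
  have "\<forall>u\<in>{0..10::int}. u ^ 2 mod 11 \<in> {0, 1, 3, 4, 5, 9}"
    by (simp add: simp_from_to)
  moreover have "x mod 11 \<in> {0..10}"
    using pos_mod_bound[of 11 x] by simp
  ultimately have "(x mod 11) ^ 2 mod 11 \<in> {0, 1, 3, 4, 5, 9}"
    by (rule bspec)
  thus ?thesis
    by (simp add: power_mod)
qed

text \<open>
  For these residues \<open>24 r + 1\<close> is not a square modulo 11.
\<close>
lemma residue_part_11_euler: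
  assumes "r \<in> {3, 6, 8, 9, 10}"
  shows "residue_part 11 r euler = 0"
proof (rule fps_ext)
  fix n
  have "fps_nth euler n = 0" if "n mod 11 = r"
  proof (rule ccontr)
    assume "fps_nth euler n \<noteq> 0"
    then obtain x where "24 * int n + 1 = x ^ 2"
      by (rule euler_nth_nonzero_imp_square)
    hence "(24 * int n + 1) mod 11 \<in> {0, 1, 3, 4, 5, 9}"
      using square_mod_11[of x] by (simp only:)
    moreover have "[int n = int r] (mod int 11)"
      unfolding cong_int_iff using that by (auto simp: cong_def)
    hence "[24 * int n + 1 = 24 * int r + 1] (mod 11)"
      by (intro cong_add cong_mult cong_refl) simp
    ultimately show False
      using assms by (auto simp: cong_def)
  qed
  thus "fps_nth (residue_part 11 r euler) n = fps_nth 0 n"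
    by simp
qed

text \<open>
  For these residues \<open>8 r + 1\<close> is not a square modulo 11.
\<close>
lemma residue_part_11_euler_cube:
  assumes "r \<in> {2, 5, 7, 8, 9}"
  shows "residue_part 11 r (euler ^ 3) = 0"
proof (rule fps_ext)
  fix n
  have "fps_nth (euler ^ 3) n = 0" if "n mod 11 = r"
  proof (rule ccontr)
    assume "fps_nth (euler ^ 3) n \<noteq> 0"
    then obtain y where "8 * int n + 1 = y ^ 2"
      by (rule euler_cube_nth)
    hence "(8 * int n + 1) mod 11 \<in> {0, 1, 3, 4, 5, 9}"
      using square_mod_11[of y] by (simp only:)
    moreover have "[int n = int r] (mod int 11)"
      unfolding cong_int_iff using that by (auto simp: cong_def)
    hence "[8 * int n + 1 = 8 * int r + 1] (mod 11)"
      by (intro cong_add cong_mult cong_refl) simp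
    ultimately show False
      using assms by (auto simp: cong_def)
  qed
  thus "fps_nth (residue_part 11 r (euler ^ 3)) n = fps_nth 0 n"
    by simp
qed

text \<open>
  Here \<open>8 n + 1\<close> is divisible by 11, and hence so is its square root.
\<close>
lemma eleven_dvd_euler_cube:
  assumes "n mod 11 = 4"
  shows "11 dvd fps_nth (euler ^ 3) n"
proof (cases "fps_nth (euler ^ 3) n = 0")
  case False
  then obtain y where y: "8 * int n + 1 = y ^ 2" "y dvd fps_nth (euler ^ 3) n"
    by (rule euler_cube_nth)
  have "[int n = int 4] (mod int 11)"
    unfolding cong_int_iff using assms by (simp add: cong_def)
  hence "[8 * int n + 1 = 8 * int 4 + 1] (mod 11)"
    by (intro cong_add cong_mult cong_refl) simp
  hence "11 dvd 8 * int n + 1"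
    by (simp add: cong_def dvd_eq_mod_eq_0)
  hence "11 dvd y"
    unfolding y(1) using prime_dvd_power[of "11 :: int" y 2] by simp
  thus ?thesis
    using y(2) by (rule dvd_trans)
qed simp

lemma eleven_dvd_euler_power_10: "11 dvd fps_nth (euler ^ 10) (11 * n + 6)"
proof -
  \<comment> \<open>Dropping the residue 4, which is 0 modulo 11, leaves exactly five residue parts.\<close>
  define J where "J = euler ^ 3 - residue_part 11 4 (euler ^ 3)"
  let ?E11 = "euler oo fps_X ^ 11"
  have J: "[euler ^ 3 = J] (rmod fps_const 11)"
    unfolding ring_cong_fps_const_iff using eleven_dvd_euler_cube
    by (auto simp: J_def ring_cong_def)
  have frobenius: "[?E11 = euler ^ 11] (rmod fps_const 11)"
    using fps_power_prime_cong[of 11 euler] by (auto intro: ring_cong_sym)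
  have R: "[residue_part 11 r (J ^ 4) = 0] (rmod fps_const 11)" if "r \<in> {3, 6, 8, 9, 10}" for r
  proof -
    have "[J ^ 4 = (euler ^ 3) ^ 4] (rmod fps_const 11)"
      by (intro ring_cong_power ring_cong_sym[OF J])
    also have "(euler ^ 3) ^ 4 = euler * euler ^ 11"
      by (simp flip: power_mult power_Suc)
    also have "[euler * euler ^ 11 = euler * ?E11] (rmod fps_const 11)"
      by (intro ring_cong_mult ring_cong_refl ring_cong_sym[OF frobenius])
    finally have "[residue_part 11 r (J ^ 4) = residue_part 11 r (euler * ?E11)] (rmod fps_const 11)"
      by (rule residue_part_cong)
    thus ?thesis
      using residue_part_11_euler[OF that] by (simp add: residue_part_mult_compose)
  qed
  have J_zero: "residue_part 11 r J = 0" if "r \<in> {2, 4, 5, 7, 8, 9}" for r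
  proof (rule fps_ext)
    fix n
    show "fps_nth (residue_part 11 r J) n = fps_nth 0 n"
    proof (cases "r = 4")
      case False
      hence "fps_nth (residue_part 11 r (euler ^ 3)) n = fps_nth 0 n"
        using residue_part_11_euler_cube[of r] that by auto
      thus ?thesis
        by (simp add: J_def split: if_splits)
    qed (simp add: J_def)
  qed
  obtain M3 M6 M8 M9 M10 H where "residue_part 11 6 (J ^ 7) =
           residue_part 11 3 (J ^ 4) * M3 + residue_part 11 6 (J ^ 4) * M6 +
           residue_part 11 8 (J ^ 4) * M8 + residue_part 11 9 (J ^ 4) * M9 +
           residue_part 11 10 (J ^ 4) * M10 + 11 * H"
    using residue_part_power_7_in_ideal[OF J_zero] by blast
  also have "[residue_part 11 3 (J ^ 4) * M3 + residue_part 11 6 (J ^ 4) * M6 +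
           residue_part 11 8 (J ^ 4) * M8 + residue_part 11 9 (J ^ 4) * M9 +
           residue_part 11 10 (J ^ 4) * M10 + 11 * H =
           0 * M3 + 0 * M6 + 0 * M8 + 0 * M9 + 0 * M10 + 0] (rmod fps_const 11)"
    by (intro ring_cong_add ring_cong_mult ring_cong_refl R)
       (simp_all add: ring_cong_def numeral_fps_const)
  finally have J7: "[residue_part 11 6 (J ^ 7) = 0] (rmod fps_const 11)"
    by simp
  have "[euler ^ 10 * ?E11 = euler ^ 10 * euler ^ 11] (rmod fps_const 11)"
    by (intro ring_cong_mult ring_cong_refl frobenius)
  also have "euler ^ 10 * euler ^ 11 = (euler ^ 3) ^ 7"
    by (simp flip: power_mult power_add)
  also have "[(euler ^ 3) ^ 7 = J ^ 7] (rmod fps_const 11)"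
    by (intro ring_cong_power J)
  finally have "[residue_part 11 6 (euler ^ 10 * ?E11) = residue_part 11 6 (J ^ 7)] (rmod fps_const 11)"
    by (rule residue_part_cong)
  from this J7 have "[residue_part 11 6 (euler ^ 10 * ?E11) = 0] (rmod fps_const 11)"
    by (rule ring_cong_trans)
  hence "[residue_part 11 6 (euler ^ 10) * ?E11 * (partition_gf oo fps_X ^ 11) =
          0 * (partition_gf oo fps_X ^ 11)] (rmod fps_const 11)"
    unfolding residue_part_mult_compose by (rule ring_cong_mult) simp
  moreover have "?E11 * (partition_gf oo fps_X ^ 11) = 1"
    by (simp flip: fps_compose_mult_distrib)
  ultimately have "[residue_part 11 6 (euler ^ 10) = 0] (rmod fps_const 11)"
    by (simp add: mult.assoc)
  from this[unfolded ring_cong_fps_const_iff, rule_format, of "11 * n + 6"] show ?thesis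
    by (simp add: ring_cong_def)
qed

section \<open>Arithmetic progressions in power series\<close>

definition fps_section :: "nat \<Rightarrow> nat \<Rightarrow> 'a::comm_ring_1 fps \<Rightarrow> 'a fps" where
  "fps_section d r f = Abs_fps (\<lambda>n. fps_nth f (d * n + r))"

lemma fps_section_nth [simp]: "fps_nth (fps_section d r f) n = fps_nth f (d * n + r)"
  by (simp add: fps_section_def)

text \<open>
  Only the multiples of \<open>d\<close> occur as exponents of \<open>g(q\<^sup>d)\<close>, so this factor can be pulled out of the
  section, where \<open>q\<^sup>d\<close> becomes \<open>q\<close>.
\<close>
lemma fps_section_mult_compose:
  assumes "r < d"
  shows "fps_section d r (f * (g oo fps_X ^ d)) = fps_section d r f * g"
proof (rule fps_ext)
  fix n
  define h where "h = (\<lambda>i. (if d dvd i then fps_nth g (i div d) else 0) * fps_nth f (d * n + r - i))"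
  have d: "d > 0"
    using assms by simp
  have "fps_nth (fps_section d r (f * (g oo fps_X ^ d))) n = fps_nth ((g oo fps_X ^ d) * f) (d * n + r)"
    by (simp add: mult.commute)
  also have "\<dots> = (\<Sum>i=0..d * n + r. h i)"
    by (simp add: fps_mult_nth fps_nth_compose_X_power h_def)
  also have "\<dots> = (\<Sum>i\<in>(\<lambda>j. d * j) ` {0..n}. h i)"
  proof (rule sum.mono_neutral_right)
    show "(\<lambda>j. d * j) ` {0..n} \<subseteq> {0..d * n + r}"
      by (auto simp: trans_le_add1)
    show "\<forall>i\<in>{0..d * n + r} - (\<lambda>j. d * j) ` {0..n}. h i = 0"
    proof
      fix i assume i: "i \<in> {0..d * n + r} - (\<lambda>j. d * j) ` {0..n}"
      have "\<not> d dvd i"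
      proof
        assume "d dvd i"
        then obtain j where j: "i = d * j" ..
        hence "d * j < d * Suc n"
          using i assms by simp
        hence "j \<le> n"
          by (simp only: mult_less_cancel1 less_Suc_eq_le)
        thus False
          using i j by auto
      qed
      thus "h i = 0"
        by (simp add: h_def)
    qed
  qed simp
  also have "\<dots> = (\<Sum>j=0..n. h (d * j))"
    using d by (subst sum.reindex) (auto simp: inj_on_def)
  also have "\<dots> = (\<Sum>j=0..n. fps_nth g j * fps_nth (fps_section d r f) (n - j))"
    using d by (intro sum.cong refl) (simp add: h_def diff_mult_distrib2)
  also have "\<dots> = fps_nth (fps_section d r f * g) n"
    by (simp add: fps_mult_nth mult.commute[of "fps_section d r f"])
  finally show "fps_nth (fps_section d r (f * (g oo fps_X ^ d))) n =
                  fps_nth (fps_section d r f * g) n" .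
qed

text \<open>
  A square root of \<open>24 n + 1\<close> is coprime to 6, hence up to sign of the form \<open>6 m - 1\<close>.
\<close>
lemma square_imp_pentagonal:
  assumes "24 * int n + 1 = t ^ 2"
  obtains m where "24 * int n + 1 = (6 * m - 1) ^ 2"
proof -
  have "[t = t mod 6] (mod 6)"
    by (simp add: cong_def)
  hence "[t ^ 2 = (t mod 6) ^ 2] (mod 6)"
    by (rule cong_pow)
  moreover have "t ^ 2 mod 6 = 1"
    unfolding assms [symmetric] by presburger
  ultimately have "(t mod 6) ^ 2 mod 6 = 1"
    by (simp add: cong_def)
  moreover have "\<forall>u\<in>{0..5::int}. u ^ 2 mod 6 = 1 \<longrightarrow> u = 1 \<or> u = 5"
    by (simp add: simp_from_to)
  moreover have "t mod 6 \<in> {0..5}"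
    using pos_mod_bound[of 6 t] by simp
  ultimately have "t mod 6 = 1 \<or> t mod 6 = 5"
    by blast
  hence "\<exists>m. t = 6 * m - 1 \<or> t = - (6 * m - 1)"
    by presburger
  then obtain m where "t = 6 * m - 1 \<or> t = - (6 * m - 1)" ..
  hence "t ^ 2 = (6 * m - 1) ^ 2"
    by (simp only: power2_eq_iff)
  with assms that show ?thesis
    by simp
qed

text \<open>
  Multiplying by \<open>p\<^sup>2\<close> maps squares \<open>24 n + 1\<close> to squares \<open>24 (p\<^sup>2 n + r) + 1\<close> and back. The integer
  \<open>m\<^sub>0\<close> with \<open>\<plusminus> p = 6 m\<^sub>0 - 1\<close> determines the sign.
\<close>
lemma euler_nth_section_square:
  assumes p: "prime p" "int p = \<bar>6 * m0 - 1\<bar>" and r: "24 * r + 1 = p ^ 2"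
  shows "fps_nth euler (p ^ 2 * n + r) = (-1) ^ nat \<bar>m0\<bar> * fps_nth euler n"
proof -
  have r': "24 * int r + 1 = int p ^ 2"
    using arg_cong[OF r, of int] by simp
  have p_sq: "int p ^ 2 = (6 * m0 - 1) ^ 2"
    using p(2) by simp
  have index: "24 * int (p ^ 2 * n + r) + 1 = int p ^ 2 * (24 * int n + 1)"
    using r' by (simp add: algebra_simps)
  show ?thesis
  proof (cases "\<exists>m. 24 * int n + 1 = (6 * m - 1) ^ 2")
    case True
    then obtain m where m: "24 * int n + 1 = (6 * m - 1) ^ 2" ..
    \<comment> \<open>Note that \<open>(6 m - 1) (6 m\<^sub>0 - 1) = - (6 (m + m\<^sub>0 - 6 m m\<^sub>0) - 1)\<close>.\<close>
    have "24 * int (p ^ 2 * n + r) + 1 = (6 * (m + m0 - 6 * m * m0) - 1) ^ 2"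
      unfolding index p_sq m by (simp add: power2_eq_square algebra_simps)
    hence "fps_nth euler (p ^ 2 * n + r) = (-1) ^ nat \<bar>m + m0 - 6 * m * m0\<bar>"
      by (rule euler_nth_pentagonal)
    also have "\<dots> = (-1) ^ nat \<bar>m0\<bar> * (-1) ^ nat \<bar>m\<bar>"
      by (simp add: minus_one_power_nat_abs)
    finally show ?thesis
      by (simp add: euler_nth_pentagonal[OF m])
  next
    case False
    have "24 * int (p ^ 2 * n + r) + 1 \<noteq> (6 * m - 1) ^ 2" for m
    proof
      assume *: "24 * int (p ^ 2 * n + r) + 1 = (6 * m - 1) ^ 2"
      have p0: "p > 0"
        using p(1) by (simp add: prime_gt_0_nat)
      have "int p ^ 2 dvd (6 * m - 1) ^ 2"
        unfolding * [symmetric] index by simp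
      hence "int p dvd 6 * m - 1"
        by (simp add: pow_divides_pow_iff)
      then obtain t where t: "6 * m - 1 = int p * t" ..
      have "int p ^ 2 * (24 * int n + 1) = int p ^ 2 * t ^ 2"
        using * unfolding index t by (simp add: power_mult_distrib)
      hence "24 * int n + 1 = t ^ 2"
        using p0 by simp
      thus False
        using False square_imp_pentagonal by blast
    qed
    hence "fps_nth euler (p ^ 2 * n + r) = 0"
      by (rule euler_nth_not_pentagonal)
    moreover have "fps_nth euler n = 0"
      using False by (intro euler_nth_not_pentagonal) auto
    ultimately show ?thesis
      by simp
  qed
qed

text \<open>
  If \<open>24 (p i + r) + 1 = 24 p i + p\<^sup>2\<close> is a square, its root is divisible by \<open>p\<close>, so the number
  is divisible by \<open>p\<^sup>2\<close>, and \<open>p\<close> divides \<open>24 i\<close>.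
\<close>
lemma euler_nth_section_prime:
  assumes p: "prime p" "p > 3" and r: "24 * r + 1 = p ^ 2" and i: "\<not> p dvd i"
  shows "fps_nth euler (p * i + r) = 0"
proof (rule ccontr)
  assume "fps_nth euler (p * i + r) \<noteq> 0"
  then obtain x where "24 * int (p * i + r) + 1 = x ^ 2"
    by (rule euler_nth_nonzero_imp_square)
  moreover have "int (24 * r + 1) = int (p ^ 2)"
    by (simp only: r)
  ultimately have x: "x ^ 2 = int p * (24 * int i + int p)"
    by (simp add: algebra_simps power2_eq_square)
  hence "int p dvd x ^ 2"
    by simp
  hence "int p dvd x"
    using p(1) by (simp add: prime_dvd_power_iff)
  hence "int p * int p dvd int p * (24 * int i + int p)"
    unfolding x [symmetric] power2_eq_square by (intro mult_dvd_mono)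
  hence "int p dvd 24 * int i"
    using p(2) by (simp add: dvd_add_left_iff)
  hence "p dvd 24 * i"
    by (metis int_dvd_int_iff of_nat_mult of_nat_numeral)
  hence "p dvd 2 ^ 3 * 3"
    using i p(1) by (simp add: prime_dvd_mult_iff)
  hence "p dvd 2 \<or> p dvd 3"
    using p(1) by (metis prime_dvd_mult_iff prime_dvd_power)
  thus False
    using p(2) by (auto dest: dvd_imp_le)
qed

lemma fps_section_prime_euler:
  assumes p: "prime p" "p > 3" "int p = \<bar>6 * m0 - 1\<bar>" and r: "24 * r + 1 = p ^ 2"
  shows "fps_section p r euler = fps_const ((-1) ^ nat \<bar>m0\<bar>) * (euler oo fps_X ^ p)"
proof (rule fps_ext)
  fix n
  show "fps_nth (fps_section p r euler) n =
          fps_nth (fps_const ((-1) ^ nat \<bar>m0\<bar>) * (euler oo fps_X ^ p)) n"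
  proof (cases "p dvd n")
    case True
    then obtain k where k: "n = p * k" ..
    show ?thesis
      using euler_nth_section_square[OF p(1,3) r, of k] p(2)
      by (simp add: k fps_nth_compose_X_power power2_eq_square mult.assoc)
  next
    case False
    thus ?thesis
      using euler_nth_section_prime[OF p(1,2) r False] by (simp add: fps_nth_compose_X_power)
  qed
qed

lemma fps_section_prime_square_euler:
  assumes p: "prime p" "int p = \<bar>6 * m0 - 1\<bar>" and r: "24 * r + 1 = p ^ 2"
  shows "fps_section (p ^ 2) r euler = fps_const ((-1) ^ nat \<bar>m0\<bar>) * euler"
  using euler_nth_section_square[OF assms] by (simp add: fps_eq_iff)

section \<open>Descent along odd powers of a prime\<close>

text \<open>The quotient \<open>(q;q)\<^sub>\<infinity> / (q\<^sup>k;q\<^sup>k)\<^sub>\<infinity>\<close>.\<close>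
definition euler_quotient :: "nat \<Rightarrow> int fps" where
  "euler_quotient k = euler * (partition_gf oo fps_X ^ k)"

lemma euler_quotient_descent:
  assumes p: "prime p" "int p = \<bar>6 * m0 - 1\<bar>" and r: "24 * r + 1 = p ^ 2" and "k > 0"
  shows "fps_nth (euler_quotient (p ^ 2 * k)) (p ^ 2 * n + r) =
           (-1) ^ nat \<bar>m0\<bar> * fps_nth (euler_quotient k) n"
proof -
  have "r < p ^ 2"
    using r by simp
  have "euler_quotient (p ^ 2 * k) = euler * ((partition_gf oo fps_X ^ k) oo fps_X ^ (p ^ 2))"
    using assms(4) prime_gt_0_nat[OF p(1)]
    by (simp add: euler_quotient_def fps_compose_X_power_compose_X_power mult.commute)
  hence "fps_section (p ^ 2) r (euler_quotient (p ^ 2 * k)) =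
           fps_const ((-1) ^ nat \<bar>m0\<bar>) * euler_quotient k"
    using fps_section_prime_square_euler[OF p r]
    by (simp add: fps_section_mult_compose[OF \<open>r < p ^ 2\<close>] euler_quotient_def[of k] mult.assoc)
  from arg_cong[OF this, of "\<lambda>f. fps_nth f n"] show ?thesis
    by simp
qed

text \<open>
  The section of \<open>E(q) / E(q\<^sup>p)\<close> is \<open>\<plusminus> E(q\<^sup>p) / E(q)\<close>, which is congruent to \<open>\<plusminus> E(q)\<^sup>p / E(q)\<close>.
\<close>
lemma euler_quotient_prime_cong:
  assumes p: "prime p" "p > 3" "int p = \<bar>6 * m0 - 1\<bar>" and r: "24 * r + 1 = p ^ 2" "r < p"
  shows "[fps_nth (euler_quotient p) (p * i + r) =
            (-1) ^ nat \<bar>m0\<bar> * fps_nth (euler ^ (p - 1)) i] (rmod int p)"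
proof -
  have "[euler oo fps_X ^ p = euler ^ p] (rmod fps_const (int p))"
    by (rule ring_cong_sym) (rule fps_power_prime_cong[OF p(1)])
  moreover have "fps_section p r (euler_quotient p) =
      fps_const ((-1) ^ nat \<bar>m0\<bar>) * ((euler oo fps_X ^ p) * partition_gf)"
    using fps_section_prime_euler[OF p r(1)]
    by (simp add: fps_section_mult_compose[OF r(2)] euler_quotient_def mult.assoc)
  ultimately have "[fps_section p r (euler_quotient p) =
      fps_const ((-1) ^ nat \<bar>m0\<bar>) * (euler ^ p * partition_gf)] (rmod fps_const (int p))"
    by (simp only:) (intro ring_cong_mult ring_cong_refl)
  also have "euler ^ p * partition_gf = euler ^ (p - 1) * (euler * partition_gf)"
    using p(2) by (simp add: power_eq_if mult_ac)
  also have "\<dots> = euler ^ (p - 1)"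
    by simp
  finally have "[fps_nth (fps_section p r (euler_quotient p)) i =
      fps_nth (fps_const ((-1) ^ nat \<bar>m0\<bar>) * euler ^ (p - 1)) i] (rmod int p)"
    unfolding ring_cong_fps_const_iff by blast
  thus ?thesis
    by simp
qed

text \<open>
  The descent, read upwards: from \<open>k\<close> to \<open>p\<^sup>2 k\<close> the index \<open>M\<close> becomes \<open>p\<^sup>2 M + r\<close>, so
  \<open>24 M + 1\<close> is multiplied by \<open>p\<^sup>2\<close>.
\<close>
lemma prime_dvd_euler_quotient:
  assumes p: "prime p" "p > 3" "int p = \<bar>6 * m0 - 1\<bar>" and r: "24 * r + 1 = p ^ 2" "r < p"
    and ramanujan: "\<And>n. int p dvd fps_nth (euler ^ (p - 1)) (p * n + s)"
  shows "\<exists>M. 24 * M + 1 = (24 * s + p) * p ^ (2 * b + 1) \<and>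
             (\<forall>n. int p dvd fps_nth (euler_quotient (p ^ (2 * b + 1))) (p ^ (2 * b + 2) * n + M))"
proof (induction b)
  case 0
  have "int p dvd fps_nth (euler_quotient p) (p ^ 2 * n + (p * s + r))" for n
  proof -
    have "[fps_nth (euler_quotient p) (p * (p * n + s) + r) =
             (-1) ^ nat \<bar>m0\<bar> * fps_nth (euler ^ (p - 1)) (p * n + s)] (rmod int p)"
      by (rule euler_quotient_prime_cong[OF p r])
    moreover have "int p dvd (-1) ^ nat \<bar>m0\<bar> * fps_nth (euler ^ (p - 1)) (p * n + s)"
      by (intro dvd_mult ramanujan)
    ultimately have "int p dvd fps_nth (euler_quotient p) (p * (p * n + s) + r)"
      unfolding ring_cong_def by (metis diff_add_cancel dvd_add)
    moreover have "p * (p * n + s) + r = p ^ 2 * n + (p * s + r)"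
      by (simp add: power2_eq_square algebra_simps)
    ultimately show ?thesis
      by simp
  qed
  moreover have "24 * (p * s + r) + 1 = (24 * s + p) * p"
    using r(1) by (simp add: power2_eq_square algebra_simps)
  ultimately show ?case
    by (intro exI[of _ "p * s + r"]) (simp add: power2_eq_square)
next
  case (Suc b)
  then obtain M where M: "24 * M + 1 = (24 * s + p) * p ^ (2 * b + 1)"
    "\<And>n. int p dvd fps_nth (euler_quotient (p ^ (2 * b + 1))) (p ^ (2 * b + 2) * n + M)"
    by blast
  have powers: "p ^ (2 * Suc b + 1) = p ^ 2 * p ^ (2 * b + 1)"
    "p ^ (2 * Suc b + 2) = p ^ 2 * p ^ (2 * b + 2)"
    by (simp_all flip: power_add)
  have "24 * (p ^ 2 * M + r) + 1 = p ^ 2 * (24 * M + 1)"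
    using r(1) by (simp add: algebra_simps)
  also have "\<dots> = (24 * s + p) * p ^ (2 * Suc b + 1)"
    unfolding M(1) powers by (simp only: mult_ac)
  finally have "24 * (p ^ 2 * M + r) + 1 = (24 * s + p) * p ^ (2 * Suc b + 1)" .
  moreover have "int p dvd fps_nth (euler_quotient (p ^ (2 * Suc b + 1)))
                   (p ^ (2 * Suc b + 2) * n + (p ^ 2 * M + r))" for n
  proof -
    have "fps_nth (euler_quotient (p ^ 2 * p ^ (2 * b + 1))) (p ^ 2 * (p ^ (2 * b + 2) * n + M) + r) =
      (-1) ^ nat \<bar>m0\<bar> * fps_nth (euler_quotient (p ^ (2 * b + 1))) (p ^ (2 * b + 2) * n + M)"
      using p(2) by (intro euler_quotient_descent[OF p(1,3) r(1)]) simp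
    moreover have "p ^ 2 * (p ^ (2 * b + 2) * n + M) + r = p ^ (2 * Suc b + 2) * n + (p ^ 2 * M + r)"
      unfolding powers by (simp add: algebra_simps)
    ultimately show ?thesis
      unfolding powers(1) using M(2)[of n] by (simp only: dvd_mult)
  qed
  ultimately show ?case
    by blast
qed

section \<open>Bracelet partitions\<close>

text \<open>
  With \<open>B = (-q;q)\<^sub>\<infinity>\<close> the generating function \<open>G\<close> satisfies \<open>G E(q)\<^bsup>k-1\<^esup> B(q\<^sup>k) = B(q)\<close>. Multiplying by
  \<open>E(q)\<close> and replacing \<open>E(q)\<^sup>k\<close> by \<open>E(q\<^sup>k)\<close>, both sides become values of \<open>E B = E(q\<^sup>2)\<close>, which gives
  \<open>G E(q\<^bsup>2k\<^esup>) \<equiv> E(q\<^sup>2)\<close>.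
\<close>
lemma dots_bracelet_cong:
  assumes p: "prime p" and k: "k = p ^ m" "k \<ge> 3"
  shows "[dots_bracelet k (2 * N) = fps_nth (euler_quotient k) N] (mod int p)"
proof -
  define G where "G = Abs_fps (dots_bracelet k)"
  define B where "B = qpochhammer_inf (- fps_X) fps_X"
  define Ek Pk where "Ek = euler oo fps_X ^ k" and "Pk = partition_gf oo fps_X ^ k"
  have Ek_Pk: "(Ek oo fps_X ^ 2) * (Pk oo fps_X ^ 2) = 1"
    using k(2) by (simp add: Ek_def Pk_def flip: fps_compose_mult_distrib)
  have "(Ek oo fps_X ^ 2) = (euler oo fps_X ^ 2) oo fps_X ^ k"
    using k(2) by (simp add: Ek_def fps_compose_X_power_compose_X_power mult.commute)
  also have "\<dots> = Ek * (B oo fps_X ^ k)"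
    using k(2) by (simp add: Ek_def B_def fps_compose_mult_distrib flip: euler_mult_neg_qpochhammer)
  finally have Ek_B: "Ek oo fps_X ^ 2 = Ek * (B oo fps_X ^ k)" .
  have gf: "G * (euler ^ (k - 1) * (B oo fps_X ^ k)) = B"
    using dots_bracelet_gf[OF k(2)] k(2)
    by (simp add: G_def B_def dots_bracelet_denom_def dots_bracelet_num_def neg_qpochhammer_compose)
  have "G * (euler ^ k * (B oo fps_X ^ k)) = euler * (G * (euler ^ (k - 1) * (B oo fps_X ^ k)))"
    using k(2) by (simp add: power_eq_if mult_ac)
  also have "\<dots> = euler oo fps_X ^ 2"
    unfolding gf unfolding B_def by (rule euler_mult_neg_qpochhammer)
  finally have eq: "G * (euler ^ k * (B oo fps_X ^ k)) = euler oo fps_X ^ 2" .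
  have "[Ek = euler ^ k] (rmod fps_const (int p))"
    unfolding Ek_def k(1) by (rule ring_cong_sym) (rule fps_power_prime_power_cong[OF p])
  hence "[G * (Ek * (B oo fps_X ^ k)) = G * (euler ^ k * (B oo fps_X ^ k))] (rmod fps_const (int p))"
    by (intro ring_cong_mult ring_cong_refl)
  hence "[G * (Ek oo fps_X ^ 2) = euler oo fps_X ^ 2] (rmod fps_const (int p))"
    by (simp only: eq Ek_B)
  hence "[G * (Ek oo fps_X ^ 2) * (Pk oo fps_X ^ 2) = (euler oo fps_X ^ 2) * (Pk oo fps_X ^ 2)]
           (rmod fps_const (int p))"
    by (intro ring_cong_mult ring_cong_refl)
  moreover have "(euler oo fps_X ^ 2) * (Pk oo fps_X ^ 2) = euler_quotient k oo fps_X ^ 2"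
    by (simp add: euler_quotient_def Pk_def fps_compose_mult_distrib)
  ultimately have "[G = euler_quotient k oo fps_X ^ 2] (rmod fps_const (int p))"
    by (simp add: mult.assoc Ek_Pk)
  hence "[fps_nth G (2 * N) = fps_nth (euler_quotient k oo fps_X ^ 2) (2 * N)] (mod int p)"
    by (simp add: ring_cong_fps_const_iff ring_cong_int_iff)
  thus ?thesis
    by (simp add: G_def fps_nth_compose_X_power)
qed

lemma dots_bracelet_prime_power_cong:
  assumes p: "prime p" "p > 3" "int p = \<bar>6 * m0 - 1\<bar>" and r: "24 * r + 1 = p ^ 2" "r < p"
    and ramanujan: "\<And>n. int p dvd fps_nth (euler ^ (p - 1)) (p * n + s)"
    and "\<alpha> \<ge> 1"
  shows "[dots_bracelet (p ^ (2 * \<alpha> - 1))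
            (2 * p ^ (2 * \<alpha>) * n + ((24 * s + p) * p ^ (2 * \<alpha> - 1) - 1) div 12) = 0] (mod int p)"
proof -
  obtain b where b: "2 * \<alpha> - 1 = 2 * b + 1" "2 * \<alpha> = 2 * b + 2"
    using assms(7) by (cases \<alpha>) auto
  obtain M where M: "24 * M + 1 = (24 * s + p) * p ^ (2 * b + 1)"
    "\<And>n. int p dvd fps_nth (euler_quotient (p ^ (2 * b + 1))) (p ^ (2 * b + 2) * n + M)"
    using prime_dvd_euler_quotient[OF p r ramanujan] by blast
  have "((24 * s + p) * p ^ (2 * b + 1) - 1) div 12 = 2 * M"
    unfolding M(1) [symmetric] by simp
  hence index: "2 * p ^ (2 * \<alpha>) * n + ((24 * s + p) * p ^ (2 * \<alpha> - 1) - 1) div 12 =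
                2 * (p ^ (2 * b + 2) * n + M)"
    unfolding b by simp
  have "p ^ (2 * b + 1) \<ge> p ^ 1"
    using p(2) by (intro power_increasing) auto
  hence "p ^ (2 * b + 1) \<ge> 3"
    using p(2) unfolding power_one_right by linarith
  hence "[dots_bracelet (p ^ (2 * b + 1)) (2 * (p ^ (2 * b + 2) * n + M)) =
          fps_nth (euler_quotient (p ^ (2 * b + 1))) (p ^ (2 * b + 2) * n + M)] (mod int p)"
    by (intro dots_bracelet_cong[OF p(1) refl])
  also have "[fps_nth (euler_quotient (p ^ (2 * b + 1))) (p ^ (2 * b + 2) * n + M) = 0] (mod int p)"
    using M(2) by (simp add: cong_0_iff)
  finally show ?thesis
    unfolding index unfolding b(1) .
qed

theorem corollary3p5:
  fixes \<alpha> n :: nat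
  assumes "\<alpha> \<ge> 1"
  shows "[dots_bracelet (5 ^ (2 * \<alpha> - 1))
            (2 * 5 ^ (2 * \<alpha>) * n + (101 * 5 ^ (2 * \<alpha> - 1) - 1) div 12) = 0] (mod 5) \<and>
         [dots_bracelet (7 ^ (2 * \<alpha> - 1))
            (2 * 7 ^ (2 * \<alpha>) * n + (127 * 7 ^ (2 * \<alpha> - 1) - 1) div 12) = 0] (mod 7) \<and>
         [dots_bracelet (11 ^ (2 * \<alpha> - 1))
            (2 * 11 ^ (2 * \<alpha>) * n + (155 * 11 ^ (2 * \<alpha> - 1) - 1) div 12) = 0] (mod 11)"
proof (intro conjI)
  show "[dots_bracelet (5 ^ (2 * \<alpha> - 1))
            (2 * 5 ^ (2 * \<alpha>) * n + (101 * 5 ^ (2 * \<alpha> - 1) - 1) div 12) = 0] (mod 5)"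
    using dots_bracelet_prime_power_cong[of 5 1 1 4 \<alpha> n] five_dvd_euler_power_4 assms by simp
  show "[dots_bracelet (7 ^ (2 * \<alpha> - 1))
            (2 * 7 ^ (2 * \<alpha>) * n + (127 * 7 ^ (2 * \<alpha> - 1) - 1) div 12) = 0] (mod 7)"
    using dots_bracelet_prime_power_cong[of 7 "-1" 2 5 \<alpha> n] seven_dvd_euler_power_6 assms by simp
  show "[dots_bracelet (11 ^ (2 * \<alpha> - 1))
            (2 * 11 ^ (2 * \<alpha>) * n + (155 * 11 ^ (2 * \<alpha> - 1) - 1) div 12) = 0] (mod 11)"
    using dots_bracelet_prime_power_cong[of 11 2 5 6 \<alpha> n] eleven_dvd_euler_power_10 assms by simp
qed

end
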